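(* Let $n\ge 3$ be odd. The complete set of orthogonal idempotents for $MM(D_{2n})$ consists of the following $\frac{n+1}{2}$ matrices: $$U_{triv}=\frac1n\,J,$$ corresponding to the trivial representation, and, for each $1\le j\le \frac{n-1}{2}$, corresponding to $\pi_2^j$, $$U_{\pi_2^j}=\frac2n\sum_{k=0}^{n-1}\cos(2kj\pi/n)\,P_{R^k},$$ that is, the matrix whose $(a,b)$ entry is $\frac2n\cos(2(a-b)j\pi/n)$ for $1\le a,b\le n$.
   Context: $D_{2n}$ is the dihedral group with $2n$ elements, realized as the subgroup of the symmetric group $S_n$ generated by the $n$-cycle $R=(1\,2\,\dots\,n)$ and the involution $C$ given by $C(i)=n+1-i$; its elements are $R^k$ and $CR^k$, $0\le k<n$. For $\sigma\in S_n$, $P_\sigma$ is the $n\times n$ permutation matrix with $[P_\sigma]_{ji}=1$ if $\sigma(i)=j$ and $0$ otherwise. $MM(D_{2n})\subseteq M(n,\mathbb{C})$ is the associative algebra over $\mathbb{C}$ generated by the $P_\sigma$, $\sigma\in D_{2n}$ (equivalently, their complex linear span). $J$ is the $n\times n$ matrix with all entries $1$. $\pi_2$ is the two-dimensional complex representation of $D_{2n}$ in which $R$ acts as rotation by $2\pi/n$ and $C$ as reflection across the $x$-axis on $\mathbb{R}^2$, extended to $\mathbb{C}^2$; $\pi_2^j=\pi_2\circ\varphi_j$, where $\varphi_j:D_{2n}\to D_{2n}$ is the homomorphism with $\varphi_j(R)=R^j$, $\varphi_j(C)=C$. $MM(D_{2n})$ is a semisimple algebra, hence the direct sum of its simple two-sided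 ideals; each of them is, under the action $(g_1,g_2)M=P_{g_1}MP_{g_2}^{-1}$ of $D_{2n}\times D_{2n}$, isomorphic to $\mathrm{Hom}_{\mathbb{C}}(V_\pi,V_\pi)$ for a unique irreducible representation $(\pi,V_\pi)$ of $D_{2n}$. "The complete set of orthogonal idempotents" for $MM(D_{2n})$ is the set of identity elements $U_\pi$ of these simple two-sided ideals, one for each ideal: so $U_\pi^2=U_\pi$, $U_\pi U_{\pi'}=0$ for $\pi\ne\pi'$, $\sum_\pi U_\pi=I$, and the ideal of type $\pi$ is $MM(D_{2n})U_\pi$. *)

theory Defs
  imports
    Complex_Main
    "HOL-Algebra.Ideal"
    "HOL-Algebra.Sym_Groups"
    "Jordan_Normal_Form.Matrix"
begin

definition rot_cycle :: "nat \<Rightarrow> nat \<Rightarrow> nat" where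
  "rot_cycle n i = (if i \<in> {1..n} then (if i = n then 1 else i + 1) else i)"

definition flip :: "nat \<Rightarrow> nat \<Rightarrow> nat" where
  "flip n i = (if i \<in> {1..n} then n + 1 - i else i)"

definition dihedral :: "nat \<Rightarrow> (nat \<Rightarrow> nat) monoid" where
  "dihedral n = (sym_group n)\<lparr>carrier := generate (sym_group n) {rot_cycle n, flip n}\<rparr>"

(* Matrix rows and columns are indexed from 0, the points permuted by S_n from 1. *)
definition perm_mat :: "nat \<Rightarrow> (nat \<Rightarrow> nat) \<Rightarrow> complex mat" where
  "perm_mat n \<sigma> = mat n n (\<lambda>(j, i). if \<sigma> (i + 1) = j + 1 then 1 else 0)"

inductive_set MM :: "nat \<Rightarrow> complex mat set" for n :: nat where
  gen: "\<sigma> \<in> carrier (dihedral n) \<Longrightarrow> perm_mat n \<sigma> \<in> MM n"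
| add: "A \<in> MM n \<Longrightarrow> B \<in> MM n \<Longrightarrow> A + B \<in> MM n"
| smult: "A \<in> MM n \<Longrightarrow> c \<cdot>\<^sub>m A \<in> MM n"
| mult: "A \<in> MM n \<Longrightarrow> B \<in> MM n \<Longrightarrow> A * B \<in> MM n"

definition MM_ring :: "nat \<Rightarrow> complex mat ring" where
  "MM_ring n = (ring_mat TYPE(complex) n ())\<lparr>carrier := MM n\<rparr>"

(* The exponent k of an element R^k or CR^k; it is unique for n \<ge> 3. *)
definition rot_exp :: "nat \<Rightarrow> (nat \<Rightarrow> nat) \<Rightarrow> nat" where
  "rot_exp n g = (THE k. k < n \<and> (g = rot_cycle n ^^ k \<or> g = flip n \<circ> rot_cycle n ^^ k))"

definition is_rot :: "nat \<Rightarrow> (nat \<Rightarrow> nat) \<Rightarrow> bool" where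
  "is_rot n g \<longleftrightarrow> (\<exists>k<n. g = rot_cycle n ^^ k)"

(* phi n j is the endomorphism with R |-> R^j and C |-> C: see phi_hom below. *)
definition phi :: "nat \<Rightarrow> nat \<Rightarrow> (nat \<Rightarrow> nat) \<Rightarrow> (nat \<Rightarrow> nat)" where
  "phi n j g =
     (if is_rot n g then rot_cycle n ^^ (j * rot_exp n g)
      else flip n \<circ> rot_cycle n ^^ (j * rot_exp n g))"

definition rot_mat :: "real \<Rightarrow> complex mat" where
  "rot_mat t = mat_of_rows_list 2
     [[complex_of_real (cos t), - complex_of_real (sin t)],
      [complex_of_real (sin t), complex_of_real (cos t)]]"

definition refl_mat :: "complex mat" where
  "refl_mat = mat_of_rows_list 2 [[1, 0], [0, - 1]]"

(* pi2 n is the representation sending R to the rotation by 2 pi / n and C to the reflection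
   across the x-axis: see pi2_representation below. *)
definition pi2 :: "nat \<Rightarrow> (nat \<Rightarrow> nat) \<Rightarrow> complex mat" where
  "pi2 n g =
     (if is_rot n g then rot_mat (2 * pi * real (rot_exp n g) / real n)
      else refl_mat * rot_mat (2 * pi * real (rot_exp n g) / real n))"

definition triv_rep :: "(nat \<Rightarrow> nat) \<Rightarrow> complex mat" where
  "triv_rep g = 1\<^sub>m 1"

(* The group of units of the ring of d x d matrices is GL(d, C). *)
definition representation :: "('g, 'r) monoid_scheme \<Rightarrow> nat \<Rightarrow> ('g \<Rightarrow> complex mat) \<Rightarrow> bool" where
  "representation G d \<rho> \<longleftrightarrow> \<rho> \<in> hom G (units_of (ring_mat TYPE(complex) d ()))"

definition invariant_subspace ::
  "('g, 'r) monoid_scheme \<Rightarrow> nat \<Rightarrow> ('g \<Rightarrow> complex mat) \<Rightarrow> complex vec set \<Rightarrow> bool" where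
  "invariant_subspace G d \<rho> W \<longleftrightarrow>
     W \<subseteq> carrier_vec d \<and> 0\<^sub>v d \<in> W \<and>
     (\<forall>v\<in>W. \<forall>w\<in>W. v + w \<in> W) \<and>
     (\<forall>c. \<forall>v\<in>W. c \<cdot>\<^sub>v v \<in> W) \<and>
     (\<forall>g\<in>carrier G. \<forall>v\<in>W. \<rho> g *\<^sub>v v \<in> W)"

definition irreducible_rep :: "('g, 'r) monoid_scheme \<Rightarrow> nat \<Rightarrow> ('g \<Rightarrow> complex mat) \<Rightarrow> bool" where
  "irreducible_rep G d \<rho> \<longleftrightarrow>
     0 < d \<and> representation G d \<rho> \<and>
     (\<forall>W. invariant_subspace G d \<rho> W \<longrightarrow> W = {0\<^sub>v d} \<or> W = carrier_vec d)"

(* I is isomorphic to Hom(V, V), V = C^d with action \<rho>, as a representation of D x D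
   under (g, h) M = P_g M P_h^(-1). *)
definition has_type :: "nat \<Rightarrow> complex mat set \<Rightarrow> nat \<Rightarrow> ((nat \<Rightarrow> nat) \<Rightarrow> complex mat) \<Rightarrow> bool" where
  "has_type n I d \<rho> \<longleftrightarrow>
     (\<exists>f. bij_betw f I (carrier_mat d d) \<and>
        (\<forall>A\<in>I. \<forall>B\<in>I. f (A + B) = f A + f B) \<and>
        (\<forall>c. \<forall>A\<in>I. f (c \<cdot>\<^sub>m A) = c \<cdot>\<^sub>m f A) \<and>
        (\<forall>g\<in>carrier (dihedral n). \<forall>h\<in>carrier (dihedral n). \<forall>A\<in>I.
           f (perm_mat n g * A * perm_mat n (inv\<^bsub>dihedral n\<^esub> h)) =
           \<rho> g * f A * \<rho> (inv\<^bsub>dihedral n\<^esub> h)))"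

(* Simple two-sided ideal of an algebra: minimal among the nonzero two-sided ideals.  For an algebra
   with unit such as MM n, ring ideals are automatically closed under scalars. *)
definition simple_ideal :: "'a set \<Rightarrow> ('a, 'r) ring_scheme \<Rightarrow> bool" where
  "simple_ideal I A \<longleftrightarrow>
     ideal I A \<and> I \<noteq> {\<zero>\<^bsub>A\<^esub>} \<and>
     (\<forall>K. ideal K A \<and> K \<subseteq> I \<longrightarrow> K = {\<zero>\<^bsub>A\<^esub>} \<or> K = I)"

definition ideal_identity :: "'a \<Rightarrow> 'a set \<Rightarrow> ('a, 'r) ring_scheme \<Rightarrow> bool" where
  "ideal_identity U I A \<longleftrightarrow>
     U \<in> I \<and> (\<forall>x\<in>I. U \<otimes>\<^bsub>A\<^esub> x = x \<and> x \<otimes>\<^bsub>A\<^esub> U = x)"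

(* The first conjunct determines S; the others record that every simple ideal contributes
   an element and that these are orthogonal idempotents with sum 1. *)
definition complete_orthogonal_idempotents :: "('a, 'r) ring_scheme \<Rightarrow> 'a set \<Rightarrow> bool" where
  "complete_orthogonal_idempotents A S \<longleftrightarrow>
     S = {U. \<exists>I. simple_ideal I A \<and> ideal_identity U I A} \<and>
     (\<forall>I. simple_ideal I A \<longrightarrow> (\<exists>U. ideal_identity U I A)) \<and>
     finite S \<and>
     (\<forall>U\<in>S. U \<otimes>\<^bsub>A\<^esub> U = U) \<and>
     (\<forall>U\<in>S. \<forall>V\<in>S. U \<noteq> V \<longrightarrow> U \<otimes>\<^bsub>A\<^esub> V = \<zero>\<^bsub>A\<^esub>) \<and>
     (\<Oplus>\<^bsub>A\<^esub>U\<in>S. U) = \<one>\<^bsub>A\<^esub>"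

definition corresponds ::
  "nat \<Rightarrow> complex mat \<Rightarrow> nat \<Rightarrow> ((nat \<Rightarrow> nat) \<Rightarrow> complex mat) \<Rightarrow> bool" where
  "corresponds n U d \<rho> \<longleftrightarrow>
     irreducible_rep (dihedral n) d \<rho> \<and>
     (\<exists>I. simple_ideal I (MM_ring n) \<and> ideal_identity U I (MM_ring n) \<and>
        I = {A * U | A. A \<in> MM n} \<and> has_type n I d \<rho>)"

definition U_triv :: "nat \<Rightarrow> complex mat" where
  "U_triv n = (1 / of_nat n) \<cdot>\<^sub>m mat n n (\<lambda>_. 1)"

definition U_pi2 :: "nat \<Rightarrow> nat \<Rightarrow> complex mat" where
  "U_pi2 n j = (2 / of_nat n) \<cdot>\<^sub>m
     (\<Oplus>\<^bsub>ring_mat TYPE(complex) n ()\<^esub>k\<in>{0..<n}.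
        complex_of_real (cos (2 * real k * real j * pi / real n)) \<cdot>\<^sub>m
          perm_mat n (rot_cycle n ^^ k))"

lemma rot_cycle_pow:
  "(rot_cycle n ^^ k) i = (if i \<in> {1..n} then (i - 1 + k) mod n + 1 else i)"
proof (induction k)
  case 0
  then show ?case by auto
next
  case (Suc k)
  show ?case
  proof (cases "i \<in> {1..n}")
    case True
    define m where "m = i - 1 + k"
    from True have "m mod n < n" by auto
    then have "rot_cycle n (m mod n + 1) = Suc m mod n + 1"
      by (auto simp: rot_cycle_def mod_Suc)
    with True Suc show ?thesis by (simp add: m_def)
  next
    case False
    with Suc show ?thesis by (auto simp: rot_cycle_def)
  qed
qed

lemma rot_cycle_pow_eq:
  assumes "0 < n" "a mod n = b mod n"
  shows "rot_cycle n ^^ a = rot_cycle n ^^ b"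
proof
  fix i
  have "(i - 1 + a) mod n = (i - 1 + b) mod n" using assms(2) by (intro mod_add_cong) auto
  then show "(rot_cycle n ^^ a) i = (rot_cycle n ^^ b) i" by (simp only: rot_cycle_pow)
qed

lemma rot_cycle_pow_mod:
  "0 < n \<Longrightarrow> rot_cycle n ^^ (a mod n) = rot_cycle n ^^ a"
  by (rule rot_cycle_pow_eq) auto

lemma rot_cycle_pow_inj:
  assumes "a < n" "b < n" "rot_cycle n ^^ a = rot_cycle n ^^ b"
  shows "a = b"
proof -
  have "(rot_cycle n ^^ a) 1 = (rot_cycle n ^^ b) 1" using assms(3) by simp
  then show ?thesis using assms(1,2) by (simp add: rot_cycle_pow)
qed

lemma flip_flip: "flip n \<circ> flip n = id"
  by (auto simp: flip_def fun_eq_iff)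

lemma rot_cycle_flip:
  assumes "0 < n"
  shows "rot_cycle n \<circ> flip n = flip n \<circ> rot_cycle n ^^ (n - 1)"
proof
  fix i
  show "(rot_cycle n \<circ> flip n) i = (flip n \<circ> rot_cycle n ^^ (n - 1)) i"
  proof (cases "i \<in> {1..n}")
    case True
    show ?thesis
    proof (cases "i = 1")
      case True
      with assms show ?thesis by (auto simp: rot_cycle_pow flip_def rot_cycle_def)
    next
      case False
      with True have "i - 1 + (n - 1) = n + (i - 2)" "i - 2 < n" by auto
      then have "(i - 1 + (n - 1)) mod n = i - 2" by (simp only: mod_add_self1 mod_less)
      with True False show ?thesis by (auto simp: rot_cycle_pow flip_def rot_cycle_def)
    qed
  next
    case False
    then show ?thesis by (auto simp: rot_cycle_pow flip_def rot_cycle_def)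
  qed
qed

lemma rot_cycle_pow_flip:
  assumes "0 < n"
  shows "rot_cycle n ^^ a \<circ> flip n = flip n \<circ> rot_cycle n ^^ ((n - 1) * a)"
proof (induction a)
  case (Suc a)
  have "rot_cycle n ^^ Suc a \<circ> flip n = rot_cycle n \<circ> (rot_cycle n ^^ a \<circ> flip n)"
    by (simp add: comp_assoc)
  also have "\<dots> = (rot_cycle n \<circ> flip n) \<circ> rot_cycle n ^^ ((n - 1) * a)"
    by (simp only: Suc comp_assoc)
  also have "\<dots> = flip n \<circ> rot_cycle n ^^ ((n - 1) * Suc a)"
    by (simp only: rot_cycle_flip[OF assms] comp_assoc funpow_add mult_Suc_right)
  finally show ?case .
qed simp

lemma flip_rot_neq:
  assumes "3 \<le> n"
  shows "flip n \<circ> rot_cycle n ^^ a \<noteq> rot_cycle n ^^ b"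
proof
  assume eq: "flip n \<circ> rot_cycle n ^^ a = rot_cycle n ^^ b"
  let ?f = "\<lambda>i. (flip n \<circ> rot_cycle n ^^ (a mod n)) i"
  let ?g = "\<lambda>i. (rot_cycle n ^^ (b mod n)) i"
  have e: "?f i = ?g i" for i
    using eq assms by (simp add: rot_cycle_pow_mod)
  define x y where "x = a mod n" and "y = b mod n"
  have xy: "x < n" "y < n" using assms by (auto simp: x_def y_def)
  have "n - x = y + 1"
    using e[of 1] assms xy unfolding x_def[symmetric] y_def[symmetric]
    by (simp add: rot_cycle_pow flip_def)
  moreover have "n - (1 + x) mod n = (1 + y) mod n + 1"
    using e[of 2] assms xy unfolding x_def[symmetric] y_def[symmetric]
    by (simp add: rot_cycle_pow flip_def Suc_le_eq)
  ultimately show False using assms xy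
    by (cases "1 + x = n"; cases "1 + y = n") auto
qed

lemma rot_cycle_permutes: "rot_cycle n permutes {1..n}"
proof (rule bij_imp_permutes)
  have "inj_on (rot_cycle n) {1..n}"
    by (auto simp: inj_on_def rot_cycle_def split: if_splits)
  moreover have "rot_cycle n ` {1..n} \<subseteq> {1..n}"
    by (auto simp: rot_cycle_def)
  ultimately show "bij_betw (rot_cycle n) {1..n} {1..n}"
    by (simp add: bij_betw_def endo_inj_surj)
qed (auto simp: rot_cycle_def)

lemma flip_permutes: "flip n permutes {1..n}"
proof (rule bij_imp_permutes)
  show "bij_betw (flip n) {1..n} {1..n}"
    by (rule bij_betw_byWitness[where f' = "flip n"]) (auto simp: flip_def)
qed (auto simp: flip_def)

lemma dihedral_mult: "x \<otimes>\<^bsub>dihedral n\<^esub> y = x \<circ> y"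
  by (simp add: dihedral_def sym_group_def)

lemma dihedral_rot_flip:
  assumes "0 < n"
  shows "rot_cycle n ^^ a \<circ> (flip n \<circ> rot_cycle n ^^ b) = flip n \<circ> rot_cycle n ^^ ((n - 1) * a + b)"
    "(flip n \<circ> rot_cycle n ^^ a) \<circ> (flip n \<circ> rot_cycle n ^^ b) = rot_cycle n ^^ ((n - 1) * a + b)"
    "rot_cycle n ^^ a \<circ> rot_cycle n ^^ b = rot_cycle n ^^ (a + b)"
    "(flip n \<circ> rot_cycle n ^^ a) \<circ> rot_cycle n ^^ b = flip n \<circ> rot_cycle n ^^ (a + b)"
proof -
  show 1: "rot_cycle n ^^ a \<circ> (flip n \<circ> rot_cycle n ^^ b) = flip n \<circ> rot_cycle n ^^ ((n - 1) * a + b)"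
    by (metis assms comp_assoc funpow_add rot_cycle_pow_flip)
  show "(flip n \<circ> rot_cycle n ^^ a) \<circ> (flip n \<circ> rot_cycle n ^^ b) = rot_cycle n ^^ ((n - 1) * a + b)"
    by (metis 1 comp_assoc flip_flip id_comp)
qed (simp_all add: funpow_add comp_assoc)

lemma dihedral_carrier:
  assumes "0 < n"
  shows "carrier (dihedral n) =
    (\<lambda>k. rot_cycle n ^^ k) ` {..<n} \<union> (\<lambda>k. flip n \<circ> rot_cycle n ^^ k) ` {..<n}"
    (is "_ = ?D")
proof -
  interpret S: group "sym_group n" by (rule sym_group_is_group)
  let ?G = "generate (sym_group n) {rot_cycle n, flip n}"
  have R: "rot_cycle n ^^ k \<in> ?D" for k
  proof -
    have "rot_cycle n ^^ k = rot_cycle n ^^ (k mod n)" "k mod n < n"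
      using assms by (auto simp: rot_cycle_pow_mod)
    then show ?thesis by blast
  qed
  have C: "flip n \<circ> rot_cycle n ^^ k \<in> ?D" for k
  proof -
    have "flip n \<circ> rot_cycle n ^^ k = flip n \<circ> rot_cycle n ^^ (k mod n)" "k mod n < n"
      using assms by (auto simp: rot_cycle_pow_mod)
    then show ?thesis by blast
  qed
  have mult: "x \<circ> y \<in> ?D" if "x \<in> ?D" "y \<in> ?D" for x y
  proof -
    from that(1) consider a where "x = rot_cycle n ^^ a" | a where "x = flip n \<circ> rot_cycle n ^^ a"
      by blast
    note cx = this
    from that(2) consider b where "y = rot_cycle n ^^ b" | b where "y = flip n \<circ> rot_cycle n ^^ b"
      by blast
    note cy = this
    show ?thesis
      by (rule cx; rule cy) (simp_all only: dihedral_rot_flip[OF assms] R C)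
  qed
  have car: "rot_cycle n \<in> carrier (sym_group n)" "flip n \<in> carrier (sym_group n)"
    unfolding sym_group_carrier by (rule rot_cycle_permutes flip_permutes)+
  have inv_flip: "inv\<^bsub>sym_group n\<^esub> flip n = flip n"
    by (rule S.inv_equality) (use car flip_flip in \<open>auto simp: sym_group_mult sym_group_one\<close>)
  have "rot_cycle n ^^ (n - 1) \<circ> rot_cycle n = id"
  proof -
    have "rot_cycle n ^^ (n - 1) \<circ> rot_cycle n = rot_cycle n ^^ n"
      using assms by (metis Suc_diff_1 funpow_Suc_right)
    also have "\<dots> = rot_cycle n ^^ 0" by (rule rot_cycle_pow_eq) (use assms in auto)
    finally show ?thesis by simp
  qed
  moreover have "rot_cycle n ^^ k permutes {1..n}" for k
  proof (induction k)
    case 0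
    show ?case by (simp add: permutes_def)
  next
    case (Suc k)
    show ?case unfolding funpow.simps by (rule permutes_compose[OF Suc rot_cycle_permutes])
  qed
  ultimately have inv_rot: "inv\<^bsub>sym_group n\<^esub> rot_cycle n = rot_cycle n ^^ (n - 1)"
    by (intro S.inv_equality) (use car in \<open>auto simp: sym_group_mult sym_group_one sym_group_carrier\<close>)
  have base: "id \<in> ?D" "rot_cycle n \<in> ?D" "flip n \<in> ?D"
    using R[of 0] R[of "Suc 0"] C[of 0] by (simp_all only: funpow.simps comp_id)
  have "x \<in> ?D" if "x \<in> ?G" for x
    using that
  proof induction
    case one
    show ?case unfolding sym_group_one by (rule base)
  next
    case (incl h)
    then show ?case using base by blast
  next
    case (inv h)
    then consider "h = rot_cycle n" | "h = flip n" by blast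
    then show ?case by cases (simp_all only: inv_flip inv_rot base R)
  next
    case (eng x y)
    then show ?case unfolding sym_group_mult by (intro mult)
  qed
  moreover have Rg: "rot_cycle n ^^ k \<in> ?G" for k
  proof (induction k)
    case 0
    show ?case unfolding funpow.simps using generate.one[of "sym_group n"] by (simp only: sym_group_one)
  next
    case (Suc k)
    then show ?case
      using generate.eng[OF generate.incl Suc, of "rot_cycle n"]
      by (simp only: sym_group_mult funpow.simps insertI1)
  qed
  moreover have "flip n \<circ> rot_cycle n ^^ k \<in> ?G" for k
    using generate.eng[OF generate.incl Rg, of "flip n" k] by (simp only: sym_group_mult insertI1 insertI2)
  ultimately have "?G = ?D" by blast
  then show ?thesis by (simp add: dihedral_def)
qed

lemma rot_exp_eq:
  assumes "3 \<le> n" "g = rot_cycle n ^^ a \<or> g = flip n \<circ> rot_cycle n ^^ a"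
  shows "rot_exp n g = a mod n"
  unfolding rot_exp_def
proof (rule the_equality)
  show "a mod n < n \<and> (g = rot_cycle n ^^ (a mod n) \<or> g = flip n \<circ> rot_cycle n ^^ (a mod n))"
    using assms by (auto simp: rot_cycle_pow_mod)
next
  fix k assume k: "k < n \<and> (g = rot_cycle n ^^ k \<or> g = flip n \<circ> rot_cycle n ^^ k)"
  have *: "flip n \<circ> rot_cycle n ^^ x = flip n \<circ> rot_cycle n ^^ y \<Longrightarrow> rot_cycle n ^^ x = rot_cycle n ^^ y" for x y
    by (metis comp_assoc flip_flip id_comp)
  have "rot_cycle n ^^ k = rot_cycle n ^^ a"
    using k assms flip_rot_neq[OF assms(1)] * by metis
  then show "k = a mod n"
    using k assms(1) by (intro rot_cycle_pow_inj) (auto simp: rot_cycle_pow_mod)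
qed

lemma is_rot_rot: "3 \<le> n \<Longrightarrow> is_rot n (rot_cycle n ^^ a)"
  unfolding is_rot_def by (rule exI[of _ "a mod n"]) (auto simp: rot_cycle_pow_mod)

lemma is_rot_flip: "3 \<le> n \<Longrightarrow> \<not> is_rot n (flip n \<circ> rot_cycle n ^^ a)"
  using flip_rot_neq by (auto simp: is_rot_def)

lemma phi_rot: "3 \<le> n \<Longrightarrow> phi n j (rot_cycle n ^^ a) = rot_cycle n ^^ (j * a)"
  by (auto simp: phi_def is_rot_rot rot_exp_eq[of n _ a] mod_mult_right_eq intro: rot_cycle_pow_eq)

lemma phi_flip: "3 \<le> n \<Longrightarrow>
  phi n j (flip n \<circ> rot_cycle n ^^ a) = flip n \<circ> rot_cycle n ^^ (j * a)"
  by (auto simp: phi_def is_rot_flip rot_exp_eq[of n _ a] mod_mult_right_eq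
      intro!: arg_cong[where f = "(\<circ>) (flip n)"] rot_cycle_pow_eq)

lemma dihedral_cases:
  assumes "0 < n" "x \<in> carrier (dihedral n)"
  obtains a where "x = rot_cycle n ^^ a" | a where "x = flip n \<circ> rot_cycle n ^^ a"
  using assms by (auto simp: dihedral_carrier)

lemma rot_flip_in:
  assumes "0 < n"
  shows "rot_cycle n ^^ a \<in> carrier (dihedral n)" "flip n \<circ> rot_cycle n ^^ a \<in> carrier (dihedral n)"
  using assms rot_cycle_pow_mod[of n a] mod_less_divisor[of n a]
  unfolding dihedral_carrier[OF assms] by (metis UnI1 UnI2 imageI lessThan_iff)+

lemma phi_hom:
  assumes "3 \<le> n"
  shows "phi n j \<in> hom (dihedral n) (dihedral n)"
    and "phi n j (rot_cycle n) = rot_cycle n ^^ j" and "phi n j (flip n) = flip n"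
proof -
  have n: "0 < n" using assms by simp
  show "phi n j \<in> hom (dihedral n) (dihedral n)"
  proof (rule homI)
    fix x assume "x \<in> carrier (dihedral n)"
    show "phi n j x \<in> carrier (dihedral n)"
      by (rule dihedral_cases[OF n \<open>x \<in> _\<close>]) (simp_all add: phi_rot phi_flip assms rot_flip_in n)
  next
    fix x y assume x: "x \<in> carrier (dihedral n)" and y: "y \<in> carrier (dihedral n)"
    show "phi n j (x \<otimes>\<^bsub>dihedral n\<^esub> y) = phi n j x \<otimes>\<^bsub>dihedral n\<^esub> phi n j y"
      unfolding dihedral_mult
      by (rule dihedral_cases[OF n x]; rule dihedral_cases[OF n y])
        (simp_all only: phi_rot phi_flip assms dihedral_rot_flip[OF n] algebra_simps)
  qed
  show "phi n j (rot_cycle n) = rot_cycle n ^^ j" using phi_rot[OF assms, of j 1] by simp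
  show "phi n j (flip n) = flip n" using phi_flip[OF assms, of j 0] by simp
qed

lemma mat2_eqI:
  assumes "A \<in> carrier_mat 2 2" "B \<in> carrier_mat 2 2"
    "A $$ (0,0) = B $$ (0,0)" "A $$ (0,1) = B $$ (0,1)" "A $$ (1,0) = B $$ (1,0)" "A $$ (1,1) = B $$ (1,1)"
  shows "A = B"
  using assms by (intro eq_matI) (auto simp: less_2_cases_iff)

lemma rot_mat_carrier [simp]: "rot_mat t \<in> carrier_mat 2 2" "refl_mat \<in> carrier_mat 2 2"
  by (auto simp: rot_mat_def refl_mat_def mat_of_rows_list_def)

lemma rot_mat_mult: "rot_mat s * rot_mat t = rot_mat (s + t)"
  by (rule mat2_eqI) (auto simp: rot_mat_def mat_of_rows_list_def scalar_prod_def
      cos_add sin_add numeral_2_eq_2 algebra_simps)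

lemma rot_mat_0: "rot_mat 0 = 1\<^sub>m 2"
  by (rule mat2_eqI) (auto simp: rot_mat_def mat_of_rows_list_def)

lemma refl_refl: "refl_mat * refl_mat = 1\<^sub>m 2"
  by (rule mat2_eqI) (auto simp: refl_mat_def mat_of_rows_list_def scalar_prod_def numeral_2_eq_2)

lemma rot_refl: "rot_mat t * refl_mat = refl_mat * rot_mat (- t)"
  by (rule mat2_eqI) (auto simp: refl_mat_def rot_mat_def mat_of_rows_list_def scalar_prod_def numeral_2_eq_2)

lemma rot_mat_cong: "rot_mat (t + 2 * pi * real k) = rot_mat t"
proof -
  have "cos (2 * pi * real k) = 1" "sin (2 * pi * real k) = 0"
    using cos_2npi[of k] sin_2npi[of k] by (simp_all only: mult_ac)
  then show ?thesis unfolding rot_mat_def cos_add sin_add by simp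
qed

lemma rot_mat_mod:
  assumes "0 < n"
  shows "rot_mat (2 * pi * real (a mod n) / real n) = rot_mat (2 * pi * real a / real n)"
proof -
  have "real a = real n * real (a div n) + real (a mod n)"
    by (metis mult_div_mod_eq of_nat_add of_nat_mult)
  then have "2 * pi * real a / real n =
      2 * pi * real (a mod n) / real n + 2 * pi * real (a div n)"
    using assms by (simp add: field_simps)
  then show ?thesis by (simp add: rot_mat_cong)
qed

lemma pi2_rot: "3 \<le> n \<Longrightarrow> pi2 n (rot_cycle n ^^ a) = rot_mat (2 * pi * real a / real n)"
  by (simp add: pi2_def is_rot_rot rot_exp_eq[of n _ a] rot_mat_mod)

lemma pi2_flip: "3 \<le> n \<Longrightarrow>
  pi2 n (flip n \<circ> rot_cycle n ^^ a) = refl_mat * rot_mat (2 * pi * real a / real n)"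
  by (simp add: pi2_def is_rot_flip rot_exp_eq[of n _ a] rot_mat_mod)

lemma rot_mat_exp:
  assumes "0 < n"
  shows "rot_mat (2 * pi * real (a + b) / real n) =
      rot_mat (2 * pi * real a / real n) * rot_mat (2 * pi * real b / real n)"
    and "rot_mat (2 * pi * real ((n - 1) * a) / real n) = rot_mat (- (2 * pi * real a / real n))"
proof -
  show "rot_mat (2 * pi * real (a + b) / real n) =
      rot_mat (2 * pi * real a / real n) * rot_mat (2 * pi * real b / real n)"
    by (simp add: rot_mat_mult add_divide_distrib algebra_simps)
  have "2 * pi * real ((n - 1) * a) / real n = - (2 * pi * real a / real n) + 2 * pi * real a"
    using assms by (simp add: of_nat_diff field_simps)
  then show "rot_mat (2 * pi * real ((n - 1) * a) / real n) = rot_mat (- (2 * pi * real a / real n))"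
    by (simp only: rot_mat_cong)
qed

lemma pi2_representation:
  assumes "3 \<le> n"
  shows "representation (dihedral n) 2 (pi2 n)"
    and "pi2 n (rot_cycle n) = rot_mat (2 * pi / real n)" and "pi2 n (flip n) = refl_mat"
proof -
  have n: "0 < n" using assms by simp
  note [simp] = ring_mat_simps
  have assoc: "(A * B) * C = A * (B * C)"
    if "A \<in> carrier_mat 2 2" "B \<in> carrier_mat 2 2" "C \<in> carrier_mat 2 2" for A B C :: "complex mat"
    using that by (rule assoc_mult_mat)
  let ?r = "\<lambda>a::nat. rot_mat (2 * pi * real a / real n)"
  have comm: "?r a * refl_mat = refl_mat * ?r ((n - 1) * a)" for a
    unfolding rot_refl rot_mat_exp(2)[OF n] by simp
  have rr: "refl_mat * (refl_mat * A) = A" if "A \<in> carrier_mat 2 2" for A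
    using that assoc[of refl_mat refl_mat A] by (simp add: refl_refl)
  have mult: "pi2 n (x \<circ> y) = pi2 n x * pi2 n y"
    if x: "x \<in> carrier (dihedral n)" and y: "y \<in> carrier (dihedral n)" for x y
  proof -
    have c: "?r a * (refl_mat * ?r b) = refl_mat * ?r ((n - 1) * a + b)" for a b
      using assoc[of "?r a" refl_mat "?r b"] assoc[of refl_mat "?r ((n - 1) * a)" "?r b"]
      by (simp only: comm rot_mat_exp(1)[OF n] rot_mat_carrier)
    have c': "(refl_mat * ?r a) * (refl_mat * ?r b) = ?r ((n - 1) * a + b)" for a b
      using assoc[of refl_mat "?r a" "refl_mat * ?r b"] by (simp only: c rr rot_mat_carrier mult_carrier_mat[of _ 2 2])
    have c'': "(refl_mat * ?r a) * ?r b = refl_mat * ?r (a + b)" for a b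
      using assoc[of refl_mat "?r a" "?r b"] by (simp only: rot_mat_exp(1)[OF n] rot_mat_carrier)
    show ?thesis
      by (rule dihedral_cases[OF n x]; rule dihedral_cases[OF n y])
        (simp_all only: pi2_rot pi2_flip assms dihedral_rot_flip[OF n] c c' c'' rot_mat_exp(1)[OF n])
  qed
  have id: "pi2 n id = 1\<^sub>m 2" using pi2_rot[OF assms, of 0] by (simp add: rot_mat_0)
  have car: "pi2 n x \<in> carrier_mat 2 2" for x
    by (auto simp: pi2_def intro!: mult_carrier_mat[of _ 2 2])
  have inv: "\<exists>y\<in>carrier (dihedral n). y \<circ> x = id \<and> x \<circ> y = id" if "x \<in> carrier (dihedral n)" for x
  proof -
    interpret S: group "sym_group n" by (rule sym_group_is_group)
    have "subgroup (carrier (dihedral n)) (sym_group n)"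
      unfolding dihedral_def using S.generate_is_subgroup[of "{rot_cycle n, flip n}"]
      using rot_cycle_permutes[of n] flip_permutes[of n] by (simp add: sym_group_carrier)
    from subgroup.m_inv_closed[OF this that] S.l_inv S.r_inv subgroup.mem_carrier[OF this that]
    show ?thesis by (metis sym_group_mult sym_group_one)
  qed
  show "representation (dihedral n) 2 (pi2 n)"
    unfolding representation_def
  proof (rule homI)
    fix x assume x: "x \<in> carrier (dihedral n)"
    from inv[OF x] obtain y where "y \<in> carrier (dihedral n)" "y \<circ> x = id" "x \<circ> y = id" by blast
    then have "pi2 n y * pi2 n x = 1\<^sub>m 2" "pi2 n x * pi2 n y = 1\<^sub>m 2"
      using mult x id by metis+
    then show "pi2 n x \<in> carrier (units_of (ring_mat TYPE(complex) 2 ()))"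
      using car by (auto simp: units_of_def Units_def)
  next
    fix x y assume "x \<in> carrier (dihedral n)" "y \<in> carrier (dihedral n)"
    then show "pi2 n (x \<otimes>\<^bsub>dihedral n\<^esub> y) =
        pi2 n x \<otimes>\<^bsub>units_of (ring_mat TYPE(complex) 2 ())\<^esub> pi2 n y"
      by (simp add: dihedral_mult units_of_def mult)
  qed
  show "pi2 n (rot_cycle n) = rot_mat (2 * pi / real n)" using pi2_rot[OF assms, of 1] by simp
  show "pi2 n (flip n) = refl_mat" using pi2_flip[OF assms, of 0]
    by (simp add: rot_mat_0 right_mult_one_mat[of _ 2 2])
qed

end

theory Submission
  imports Defs "HOL-Algebra.Subrings" "Jordan_Normal_Form.Determinant"
begin

text \<open>
  As a representation of the dihedral group, \<open>\<complex>\<^sup>n\<close> decomposes without multiplicities: the constant vectors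
  carry the trivial representation, and for \<open>1 \<le> j \<le> (n - 1) / 2\<close> the cosine and sine waves of
  frequency \<open>j\<close> span a copy of \<open>\<pi>\<^sub>2 \<circ> \<phi>\<^sub>j\<close>. The claimed idempotents are the orthogonal projections onto
  these subspaces.

  To turn such a subspace into a simple ideal, let the \<open>d\<close> columns of \<open>B\<close> be a basis of it and let \<open>B'\<close>
  be a left inverse of \<open>B\<close> such that both matrices intertwine the permutation matrices with the
  irreducible representation \<open>\<rho>\<close>. Then \<open>U = B B'\<close> commutes with all permutation matrices, hence it is a
  central idempotent of the algebra, and compression \<open>A \<mapsto> B' A B\<close> identifies the two-sided ideal
  generated by \<open>U\<close> with the algebra of all \<open>d \<times> d\<close> matrices, provided that the matrices
  \<open>\<rho> g\<close> span it. Simplicity of the full matrix algebra makes this ideal simple, the identification has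
  the required equivariance, and the same spanning property makes \<open>\<rho>\<close> irreducible. This
  argument is the locale \<open>intertwining_block\<close>, whose outcome is its lemma \<open>corresponds\<close>.

  For the two-dimensional blocks the waves are centred at the midpoint \<open>(n - 1) / 2\<close> of the index range,
  so that the flip fixes the cosine wave and negates the sine wave. That the two waves are
  orthogonal and have equal norms follows from Schur's lemma, since their Gram matrix commutes with an
  irreducible representation; the trace then gives the factor \<open>2 / n\<close>. The matrices \<open>\<rho> g\<close> span all
  \<open>2 \<times> 2\<close> matrices because the rotation angle \<open>2 \<pi> j / n\<close> lies strictly between \<open>0\<close> and \<open>\<pi>\<close>.

  It remains to see that no further simple ideal exists. Distinct simple ideals annihilate each
  other, so a simple ideal different from all those found would be annihilated by the sum of their
  identities. That sum is the identity matrix; in matrix entries this is the closed form of the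
  Dirichlet kernel \<open>1 + 2 \<Sum>cos (j x)\<close> at \<open>x = 2 \<pi> m / n\<close>, and here the oddness of \<open>n\<close> enters. This is
  \<open>simple_ideal_identities_complete\<close> combined with \<open>idempotents_sum\<close>.
\<close>

section \<open>Simple ideals with identity elements\<close>

lemma (in ring) ideal_of_central_element:
  assumes U: "U \<in> carrier R" and central: "\<And>x. x \<in> carrier R \<Longrightarrow> x \<otimes> U = U \<otimes> x"
  shows "ideal {x \<otimes> U | x. x \<in> carrier R} R" (is "ideal ?I R")
proof (rule idealI[OF ring_axioms])
  show "subgroup ?I (add_monoid R)"
  proof (rule add.subgroupI)
    show "?I \<subseteq> carrier R" "?I \<noteq> {}" using U by auto
    fix a b assume "a \<in> ?I"
    then obtain x where x: "x \<in> carrier R" "a = x \<otimes> U" by blast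
    have "\<ominus> a = (\<ominus> x) \<otimes> U" using x U by (simp add: l_minus)
    with x show "\<ominus> a \<in> ?I" by (auto intro!: exI[of _ "\<ominus> x"])
    assume "b \<in> ?I"
    then obtain y where y: "y \<in> carrier R" "b = y \<otimes> U" by blast
    have "a \<oplus> b = (x \<oplus> y) \<otimes> U" using x y U by (simp add: l_distr)
    with x y show "a \<oplus> b \<in> ?I" by (auto intro!: exI[of _ "x \<oplus> y"])
  qed
next
  fix a x assume "a \<in> ?I" and x: "x \<in> carrier R"
  then obtain y where y: "y \<in> carrier R" "a = y \<otimes> U" by blast
  have "x \<otimes> a = (x \<otimes> y) \<otimes> U" using x y U by (simp add: m_assoc)
  with x y show "x \<otimes> a \<in> ?I" by (auto intro!: exI[of _ "x \<otimes> y"])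
  have "a \<otimes> x = (y \<otimes> x) \<otimes> U" using x y U by (simp add: m_assoc central)
  with x y show "a \<otimes> x \<in> ?I" by (auto intro!: exI[of _ "y \<otimes> x"])
qed

text \<open>
  The intersection of the two ideals lies in both, so by minimality it is zero unless they coincide;
  the product of elements lies in the intersection.
\<close>
lemma (in ring) distinct_simple_ideals_annihilate:
  assumes "simple_ideal I R" "simple_ideal J R" "I \<noteq> J" "x \<in> I" "y \<in> J"
  shows "x \<otimes> y = \<zero>"
proof -
  have I: "ideal I R" and J: "ideal J R" using assms by (auto simp: simple_ideal_def)
  have "ideal (I \<inter> J) R" by (rule i_intersect[OF I J])
  then have "I \<inter> J = {\<zero>} \<or> I \<inter> J = I" "I \<inter> J = {\<zero>} \<or> I \<inter> J = J"
    using assms(1,2) unfolding simple_ideal_def by (meson Int_lower1 Int_lower2)+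
  then have "I \<inter> J = {\<zero>}" using assms(3) by blast
  moreover have "x \<otimes> y \<in> I \<inter> J"
    using ideal.I_r_closed[OF I] ideal.I_l_closed[OF J] ideal.Icarr[OF I] ideal.Icarr[OF J] assms(4,5)
    by blast
  ultimately show ?thesis by blast
qed

text \<open>
  A simple ideal \<open>K\<close> different from every \<open>I U\<close> is annihilated by every \<open>U\<close>, hence by their sum
  \<open>\<one>\<close>, so it is zero. Orthogonality of the family has the same source.
\<close>
lemma (in ring) simple_ideal_identities_complete:
  assumes fin: "finite S"
    and simple: "\<And>U. U \<in> S \<Longrightarrow> simple_ideal (I U) R"
    and ident: "\<And>U. U \<in> S \<Longrightarrow> ideal_identity U (I U) R"
    and total: "(\<Oplus>U\<in>S. U) = \<one>"
  shows "complete_orthogonal_idempotents R S"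
proof -
  have ideal: "ideal K R" if "simple_ideal K R" for K
    using that by (simp add: simple_ideal_def)
  have unique: "U = V" if "ideal_identity U K R" "ideal_identity V K R" for U V K
    using that unfolding ideal_identity_def by metis
  have mem: "U \<in> I U" and idem: "U \<otimes> U = U" if "U \<in> S" for U
    using ident[OF that] by (auto simp: ideal_identity_def)
  have car: "U \<in> carrier R" if "U \<in> S" for U
    using ideal.Icarr[OF ideal[OF simple[OF that]] mem[OF that]] .
  have classify: "\<exists>U\<in>S. K = I U" if K: "simple_ideal K R" for K
  proof (rule ccontr)
    assume none: "\<not> (\<exists>U\<in>S. K = I U)"
    have "x = \<zero>" if x: "x \<in> K" for x
    proof -
      have xc: "x \<in> carrier R" using ideal.Icarr[OF ideal[OF K] x] .
      have "x = x \<otimes> (\<Oplus>U\<in>S. U)" using xc by (simp add: total)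
      also have "\<dots> = (\<Oplus>U\<in>S. x \<otimes> U)"
        by (rule finsum_rdistr) (use fin xc car in auto)
      also have "\<dots> = (\<Oplus>U\<in>S. \<zero>)"
      proof (rule finsum_cong')
        fix U assume U: "U \<in> S"
        show "x \<otimes> U = \<zero>"
          by (rule distinct_simple_ideals_annihilate[OF K simple[OF U] _ x mem[OF U]]) (use none U in blast)
      qed auto
      also have "\<dots> = \<zero>" by simp
      finally show ?thesis .
    qed
    moreover have "\<zero> \<in> K"
      using additive_subgroup.zero_closed[OF ideal.axioms(1)[OF ideal[OF K]]] .
    ultimately have "K = {\<zero>}" by blast
    with K show False by (simp add: simple_ideal_def)
  qed
  have "S = {U. \<exists>K. simple_ideal K R \<and> ideal_identity U K R}"
    using simple ident classify unique by blast
  moreover have "U \<otimes> V = \<zero>" if "U \<in> S" "V \<in> S" "U \<noteq> V" for U V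
  proof -
    have "I U \<noteq> I V" using that ident unique by metis
    then show ?thesis
      using distinct_simple_ideals_annihilate simple mem that by meson
  qed
  moreover have "\<exists>U. ideal_identity U K R" if "simple_ideal K R" for K
    using classify[OF that] ident by blast
  ultimately show ?thesis
    unfolding complete_orthogonal_idempotents_def using fin idem total by meson
qed

section \<open>Permutation matrices and the algebra they span\<close>

lemma perm_mat_carrier [simp]: "perm_mat n g \<in> carrier_mat n n"
  by (simp add: perm_mat_def)

lemma perm_mat_dims [simp]: "dim_row (perm_mat n g) = n" "dim_col (perm_mat n g) = n"
  by (simp_all add: perm_mat_def)

lemma perm_mat_id: "perm_mat n id = 1\<^sub>m n"
  by (intro eq_matI) (auto simp: perm_mat_def)

lemma mult_perm_mat_index:
  assumes "X \<in> carrier_mat d n" "c < d" "i < n" "g permutes {1..n}"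
  shows "(X * perm_mat n g) $$ (c, i) = X $$ (c, g (i + 1) - 1)"
proof -
  have g: "g (i + 1) \<in> {1..n}" using assms(3) permutes_in_image[OF assms(4), of "i + 1"] by simp
  have "(X * perm_mat n g) $$ (c, i) = (\<Sum>j = 0..<n. X $$ (c, j) * (if g (i + 1) = j + 1 then 1 else 0))"
    using assms by (simp add: perm_mat_def scalar_prod_def)
  also have "\<dots> = (\<Sum>j = 0..<n. if j = g (i + 1) - 1 then X $$ (c, j) else 0)"
    using g by (intro sum.cong) auto
  also have "\<dots> = X $$ (c, g (i + 1) - 1)" using g by (simp add: sum.delta) (use assms in linarith)
  finally show ?thesis .
qed

lemma perm_mat_orthogonal:
  assumes g: "g permutes {1..n}"
  shows "transpose_mat (perm_mat n g) * perm_mat n g = 1\<^sub>m n"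
    and "perm_mat n g * transpose_mat (perm_mat n g) = 1\<^sub>m n"
proof -
  show *: "transpose_mat (perm_mat n g) * perm_mat n g = 1\<^sub>m n"
  proof (rule eq_matI)
    fix i k assume "i < dim_row (1\<^sub>m n :: complex mat)" "k < dim_col (1\<^sub>m n :: complex mat)"
    then have i: "i < n" and k: "k < n" by auto
    have "g (k + 1) \<in> {1..n}" using permutes_in_image[OF g, of "k + 1"] k by simp
    then obtain m where m: "g (k + 1) = m + 1" "m < n" by (cases "g (k + 1)") auto
    have "(transpose_mat (perm_mat n g) * perm_mat n g) $$ (i, k) =
        transpose_mat (perm_mat n g) $$ (i, g (k + 1) - 1)"
      by (rule mult_perm_mat_index) (use i k g in \<open>auto simp: perm_mat_def\<close>)
    also have "\<dots> = (if g (i + 1) = g (k + 1) then 1 else 0)"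
      using m i by (simp add: perm_mat_def)
    also have "\<dots> = 1\<^sub>m n $$ (i, k)" using i k permutes_inj[OF g] by (auto simp: inj_eq)
    finally show "(transpose_mat (perm_mat n g) * perm_mat n g) $$ (i, k) = 1\<^sub>m n $$ (i, k)" .
  qed (auto simp: perm_mat_def)
  show "perm_mat n g * transpose_mat (perm_mat n g) = 1\<^sub>m n"
    by (rule mat_mult_left_right_inverse[OF _ _ *]) auto
qed

text \<open>
  Both the permutation matrix and \<open>Q\<close> are orthogonal, so transposing an intertwining relation and
  cancelling the transposes again yields the relation for the transpose of \<open>X\<close>. It is therefore
  enough to compute the action on one side.
\<close>
lemma intertwine_transpose:
  assumes g: "g permutes {1..n}"
    and X: "X \<in> carrier_mat d n" and Q: "Q \<in> carrier_mat d d"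
    and XP: "X * perm_mat n g = Q * X" and orth: "transpose_mat Q * Q = 1\<^sub>m d"
  shows "perm_mat n g * transpose_mat X = transpose_mat X * Q"
proof -
  let ?P = "perm_mat n g" and ?T = "transpose_mat :: complex mat \<Rightarrow> complex mat"
  have T: "?T ?P * ?T X = ?T X * ?T Q"
    using arg_cong[OF XP, of ?T] transpose_mult[OF X perm_mat_carrier[of n g]] transpose_mult[OF Q X]
    by simp
  have "?P * ?T X = ?P * (?T X * (?T Q * Q))" using X by (simp add: orth)
  also have "\<dots> = ?P * ((?T X * ?T Q) * Q)"
    using X Q by (simp add: assoc_mult_mat[of _ n d _ d _ d])
  also have "\<dots> = ?P * ((?T ?P * ?T X) * Q)" by (simp only: T)
  also have "\<dots> = (?P * ?T ?P) * (?T X * Q)"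
    using X Q by (simp add: assoc_mult_mat[of _ n n _ d _ d] assoc_mult_mat[of _ n n _ n _ d])
  also have "\<dots> = ?T X * Q" using X Q by (simp add: perm_mat_orthogonal[OF g])
  finally show ?thesis .
qed

lemma dihedral_subgroup: "subgroup (carrier (dihedral n)) (sym_group n)"
proof -
  interpret group "sym_group n" by (rule sym_group_is_group)
  show ?thesis
    unfolding dihedral_def using generate_is_subgroup[of "{rot_cycle n, flip n}"]
      rot_cycle_permutes[of n] flip_permutes[of n] by (simp add: sym_group_carrier)
qed

lemma dihedral_group: "group (dihedral n)"
proof -
  interpret group "sym_group n" by (rule sym_group_is_group)
  have "sym_group n\<lparr>carrier := carrier (dihedral n)\<rparr> = dihedral n"
    by (simp add: dihedral_def)
  then show ?thesis using subgroup_imp_group[OF dihedral_subgroup] by metis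
qed

lemma dihedral_permutes: "g \<in> carrier (dihedral n) \<Longrightarrow> g permutes {1..n}"
  using subgroup.mem_carrier[OF dihedral_subgroup] by (auto simp: sym_group_carrier)

lemma dihedral_one: "id \<in> carrier (dihedral n)"
  using subgroup.one_closed[OF dihedral_subgroup] by (simp add: sym_group_one)

lemma MM_carrier: "A \<in> MM n \<Longrightarrow> A \<in> carrier_mat n n"
  by (induction rule: MM.induct) auto

lemma MM_commute:
  assumes V: "V \<in> carrier_mat n n"
    and comm: "\<And>g. g \<in> carrier (dihedral n) \<Longrightarrow> perm_mat n g * V = V * perm_mat n g"
    and A: "A \<in> MM n"
  shows "A * V = V * A"
  using A
proof (induction rule: MM.induct)
  case (gen g)
  then show ?case by (rule comm)
next
  case (add A C)
  note AC = MM_carrier[OF add.hyps(1)] MM_carrier[OF add.hyps(2)]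
  show ?case
    by (simp only: add_mult_distrib_mat[OF AC V] mult_add_distrib_mat[OF V AC] add.IH)
next
  case (smult A c)
  note A = MM_carrier[OF smult.hyps]
  show ?case
    by (simp only: mult_smult_assoc_mat[OF A V] mult_smult_distrib[OF V A] smult.IH)
next
  case (mult A C)
  note AC = MM_carrier[OF mult.hyps(1)] MM_carrier[OF mult.hyps(2)]
  have "A * C * V = A * (C * V)" by (rule assoc_mult_mat[OF AC V])
  also have "\<dots> = (A * V) * C" unfolding mult.IH(2) by (rule assoc_mult_mat[OF AC(1) V AC(2), symmetric])
  also have "\<dots> = V * (A * C)" unfolding mult.IH(1) by (rule assoc_mult_mat[OF V AC])
  finally show ?case .
qed

lemma MM_one: "1\<^sub>m n \<in> MM n"
  using MM.gen[OF dihedral_one] by (simp add: perm_mat_id)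

lemma MM_zero: "0\<^sub>m n n \<in> MM n"
proof -
  have "0 \<cdot>\<^sub>m 1\<^sub>m n = (0\<^sub>m n n :: complex mat)" by (intro eq_matI) auto
  then show ?thesis using MM.smult[OF MM_one, of 0 n] by simp
qed

lemma MM_ring_simps [simp]:
  "carrier (MM_ring n) = MM n" "monoid.mult (MM_ring n) = (*)" "ring.add (MM_ring n) = (+)"
  "\<one>\<^bsub>MM_ring n\<^esub> = 1\<^sub>m n" "\<zero>\<^bsub>MM_ring n\<^esub> = 0\<^sub>m n n"
  by (simp_all add: MM_ring_def ring_mat_simps)

lemma ring_MM_ring: "ring (MM_ring n)"
proof -
  let ?R = "ring_mat TYPE(complex) n ()"
  interpret R: ring ?R by (rule ring_mat)
  have "subring (MM n) ?R"
  proof (rule R.subringI)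
    fix A assume A: "A \<in> MM n"
    have "(- 1) \<cdot>\<^sub>m A + A = 0\<^sub>m n n"
      using MM_carrier[OF A] by (intro eq_matI) auto
    then have "\<ominus>\<^bsub>?R\<^esub> A = (- 1) \<cdot>\<^sub>m A"
      using MM_carrier[OF A] by (intro R.minus_equality) (auto simp: ring_mat_simps)
    then show "\<ominus>\<^bsub>?R\<^esub> A \<in> MM n" using MM.smult[OF A] by simp
  qed (auto simp: ring_mat_simps MM_one MM_carrier intro: MM.add MM.mult)
  from R.subring_is_ring[OF this] show ?thesis by (simp add: MM_ring_def)
qed

text \<open>
  The sums in question are taken both in the full matrix ring and in the subring \<open>MM_ring n\<close>, which
  is why the ring is left open here.
\<close>
lemma finsum_mat_index:
  assumes "abelian_monoid R" "ring.add R = (+)" "\<zero>\<^bsub>R\<^esub> = 0\<^sub>m n n" "carrier R \<subseteq> carrier_mat n n"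
    and "finite S" "f \<in> S \<rightarrow> carrier R" "a < n" "b < n"
  shows "finsum R f S $$ (a, b) = (\<Sum>x\<in>S. f x $$ (a, b))"
proof -
  interpret R: abelian_monoid R by fact
  show ?thesis
    using assms(5,6)
  proof (induction S rule: finite_induct)
    case empty
    then show ?case using assms by simp
  next
    case (insert x S)
    then have "finsum R f S \<in> carrier_mat n n" "f x \<in> carrier_mat n n"
      using assms(4) R.finsum_closed[of f S] by auto
    then show ?case using insert assms by (simp add: R.finsum_insert Pi_iff)
  qed
qed

lemma MM_finsum:
  assumes "finite S" "f \<in> S \<rightarrow> MM n"
  shows "finsum (ring_mat TYPE(complex) n ()) f S \<in> MM n"
proof -
  interpret R: ring "ring_mat TYPE(complex) n ()" by (rule ring_mat)
  show ?thesis
    using assms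
    by (induction S rule: finite_induct)
      (auto simp: ring_mat_simps MM_zero Pi_iff MM_carrier R.finsum_insert intro!: MM.add)
qed

section \<open>Blocks of the algebra given by intertwining matrices\<close>

lemma assoc_mult_mat_dim:
  fixes A B C :: "'a :: semiring_0 mat"
  assumes "dim_col A = dim_row B" "dim_col B = dim_row C"
  shows "A * B * C = A * (B * C)"
  using assms by (intro assoc_mult_mat[of A "dim_row A" "dim_row B" B "dim_row C" C "dim_col C"]) auto

text \<open>
  The full matrix algebra over a field is simple: a nonzero entry \<open>(p, q)\<close> of \<open>M\<close> can be moved by
  matrix units to any diagonal position and normalised there, and the sum of the resulting diagonal
  matrix units is the identity.
\<close>
lemma two_sided_ideal_contains_one:
  fixes K :: "'a :: field mat set"
  assumes K: "K \<subseteq> carrier_mat d d" and zero: "0\<^sub>m d d \<in> K"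
    and add: "\<And>M N. M \<in> K \<Longrightarrow> N \<in> K \<Longrightarrow> M + N \<in> K"
    and mult: "\<And>X M Y. X \<in> carrier_mat d d \<Longrightarrow> M \<in> K \<Longrightarrow> Y \<in> carrier_mat d d \<Longrightarrow> X * M * Y \<in> K"
    and M: "M \<in> K" "M \<noteq> 0\<^sub>m d d"
  shows "1\<^sub>m d \<in> K"
proof -
  have Mc: "M \<in> carrier_mat d d" using K M by blast
  then obtain p q where pq: "p < d" "q < d" "M $$ (p, q) \<noteq> 0"
    using M(2) by (metis carrier_matD eq_matI index_zero_mat)
  define e where "e i k c = mat d d (\<lambda>(a, b). if a = i \<and> b = k then c else 0)" for i k and c :: 'a
  have e: "e i k c \<in> carrier_mat d d" for i k c by (simp add: e_def)
  have left: "(e m p c * M) $$ (a, l) = (if a = m then c * M $$ (p, l) else 0)"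
    if "a < d" "l < d" for m a l c
  proof -
    have "(e m p c * M) $$ (a, l) = (\<Sum>t = 0..<d. (if a = m \<and> t = p then c else 0) * M $$ (t, l))"
      using that Mc by (simp add: e_def scalar_prod_def)
    also have "\<dots> = (\<Sum>t = 0..<d. if t = p then (if a = m then c * M $$ (p, l) else 0) else 0)"
      by (intro sum.cong) auto
    finally show ?thesis using pq by simp
  qed
  have right: "(e m p c * M * e q m 1) $$ (a, b) = (if a = m \<and> b = m then c * M $$ (p, q) else 0)"
    if "a < d" "b < d" for m a b c
  proof -
    have expand: "(X * e q m 1) $$ (a, b) = (\<Sum>l = 0..<d. X $$ (a, l) * (if l = q \<and> b = m then 1 else 0))"
      if "X \<in> carrier_mat d d" for X
      using that \<open>a < d\<close> \<open>b < d\<close> by (simp add: e_def scalar_prod_def)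
    have "(e m p c * M * e q m 1) $$ (a, b) =
        (\<Sum>l = 0..<d. (e m p c * M) $$ (a, l) * (if l = q \<and> b = m then 1 else 0))"
      by (rule expand[OF mult_carrier_mat[OF e Mc]])
    also have "\<dots> = (\<Sum>l = 0..<d. if l = q then (if b = m then (e m p c * M) $$ (a, q) else 0) else 0)"
      by (intro sum.cong) auto
    finally show ?thesis using pq that by (simp add: left)
  qed
  \<comment> \<open>The identity is reached one diagonal entry at a time.\<close>
  have "mat d d (\<lambda>(a, b). if a = b \<and> a < m then 1 else 0) \<in> K" if "m \<le> d" for m
    using that
  proof (induction m)
    case 0
    have "mat d d (\<lambda>(a, b). if a = b \<and> a < 0 then 1 else 0) = (0\<^sub>m d d :: 'a mat)"
      by (intro eq_matI) auto
    then show ?case using zero by metis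
  next
    case (Suc m)
    let ?N = "e m p (1 / M $$ (p, q)) * M * e q m 1"
    have "?N \<in> K" by (rule mult[OF e M(1) e])
    moreover have "mat d d (\<lambda>(a, b). if a = b \<and> a < m then 1 else 0) \<in> K" using Suc by simp
    moreover have N: "?N = mat d d (\<lambda>(a, b). if a = m \<and> b = m then 1 else 0)"
    proof (rule eq_matI)
      fix a b assume "a < dim_row (mat d d (\<lambda>(a, b). if a = m \<and> b = m then 1 else 0 :: 'a))"
        "b < dim_col (mat d d (\<lambda>(a, b). if a = m \<and> b = m then 1 else 0 :: 'a))"
      then have ab: "a < d" "b < d" by auto
      show "?N $$ (a, b) = mat d d (\<lambda>(a, b). if a = m \<and> b = m then 1 else 0) $$ (a, b)"
        unfolding right[OF ab] using ab pq by simp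
    qed (simp_all add: e_def)
    moreover have step: "mat d d (\<lambda>(a, b). if a = b \<and> a < Suc m then 1 else 0) =
        mat d d (\<lambda>(a, b). if a = b \<and> a < m then 1 else 0) +
        (mat d d (\<lambda>(a, b). if a = m \<and> b = m then 1 else 0) :: 'a mat)"
      by (intro eq_matI) auto
    ultimately show ?case unfolding step N[symmetric] by (intro add)
  qed
  from this[OF order_refl] show ?thesis
    by (rule back_subst[of "\<lambda>x. x \<in> K"]) (auto intro!: eq_matI)
qed

text \<open>
  The columns of \<open>B\<close> span a copy of \<open>\<rho>\<close> inside the permutation representation. The assumption
  \<open>full\<close> is the form in which irreducibility of \<open>\<rho>\<close> enters: compressing the algebra to this
  subspace produces every \<open>d \<times> d\<close> matrix.
\<close>
locale intertwining_block =
  fixes n d :: nat and B B' :: "complex mat" and \<rho> :: "(nat \<Rightarrow> nat) \<Rightarrow> complex mat"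
  assumes d: "0 < d"
    and B: "B \<in> carrier_mat n d" and B': "B' \<in> carrier_mat d n"
    and left_inverse: "B' * B = 1\<^sub>m d"
    and U_mem: "B * B' \<in> MM n"
    and rep: "representation (dihedral n) d \<rho>"
    and left: "\<And>g. g \<in> carrier (dihedral n) \<Longrightarrow> perm_mat n g * B = B * \<rho> g"
    and right: "\<And>g. g \<in> carrier (dihedral n) \<Longrightarrow> B' * perm_mat n g = \<rho> g * B'"
    and full: "\<And>M. M \<in> carrier_mat d d \<Longrightarrow> \<exists>A\<in>MM n. B' * A * B = M"
begin

abbreviation "U \<equiv> B * B'"

lemma rep_carrier: "g \<in> carrier (dihedral n) \<Longrightarrow> \<rho> g \<in> carrier_mat d d"
  using rep by (auto simp: representation_def hom_def units_of_def Units_def ring_mat_simps)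

lemmas dims = carrier_matD[OF B] carrier_matD[OF B']

lemma U_carrier: "U \<in> carrier_mat n n" using B B' by simp

lemma cancel:
  assumes "dim_row X = d"
  shows "B' * (B * X) = X"
proof -
  have "B' * (B * X) = B' * B * X" using assms by (intro assoc_mult_mat_dim[symmetric]) (simp_all add: dims)
  also have "\<dots> = X" unfolding left_inverse using assms by (intro left_mult_one_mat') simp
  finally show ?thesis .
qed

lemma U_central: "A \<in> MM n \<Longrightarrow> A * U = U * A"
proof (erule MM_commute[OF U_carrier, rotated])
  fix g assume g: "g \<in> carrier (dihedral n)"
  have "perm_mat n g * U = (perm_mat n g * B) * B'"
    by (rule assoc_mult_mat_dim[symmetric]) (simp_all add: dims)
  also have "\<dots> = B * (\<rho> g * B')"
    unfolding left[OF g] using rep_carrier[OF g] by (intro assoc_mult_mat_dim) (simp_all add: dims)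
  also have "\<dots> = U * perm_mat n g"
    unfolding right[OF g, symmetric] by (intro assoc_mult_mat_dim[symmetric]) (simp_all add: dims)
  finally show "perm_mat n g * U = U * perm_mat n g" .
qed

text \<open>
  Since \<open>U\<close> is central and \<open>U B = B\<close>, the column space of \<open>B\<close> is stable under the whole algebra, which
  acts on it through compression.
\<close>
lemma compress_intertwines:
  assumes "A \<in> MM n"
  shows "A * B = B * (B' * A * B)"
proof -
  note A = MM_carrier[OF assms]
  have "A * B = A * (B * (B' * B))" using B by (simp add: left_inverse)
  also have "\<dots> = A * U * B" using A by (simp add: assoc_mult_mat_dim dims)
  also have "\<dots> = B * (B' * A * B)" unfolding U_central[OF assms] using A by (simp add: assoc_mult_mat_dim dims)
  finally show ?thesis .
qed

lemma mult_U:
  assumes "A \<in> MM n"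
  shows "A * U = B * (B' * A * B) * B'"
proof -
  have "A * U = A * B * B'" using MM_carrier[OF assms] by (simp add: assoc_mult_mat_dim dims)
  then show ?thesis by (simp only: compress_intertwines[OF assms])
qed

text \<open>
  Expansion \<open>M \<mapsto> B M B'\<close> is the inverse of compression on the ideal. A matrix \<open>M\<close>
  that is the compression of \<open>A\<close> expands to \<open>A U\<close>, hence stays in the algebra.
\<close>
lemma expand_mem:
  assumes "M \<in> carrier_mat d d"
  shows "B * M * B' \<in> MM n"
proof -
  obtain A where "A \<in> MM n" "B' * A * B = M" using full[OF assms] by blast
  then show ?thesis using mult_U[of A] MM.mult[OF _ U_mem] by metis
qed

definition I where "I = {A * U | A. A \<in> MM n}"

lemma I_eq: "I = (\<lambda>M. B * M * B') ` carrier_mat d d"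
proof
  have "B' * A * B \<in> carrier_mat d d" if "A \<in> MM n" for A
    using mult_carrier_mat[OF mult_carrier_mat[OF B' MM_carrier[OF that]] B] .
  then show "I \<subseteq> (\<lambda>M. B * M * B') ` carrier_mat d d"
    unfolding I_def by (auto simp only: mult_U intro!: imageI)
  show "(\<lambda>M. B * M * B') ` carrier_mat d d \<subseteq> I"
  proof
    fix x assume "x \<in> (\<lambda>M. B * M * B') ` carrier_mat d d"
    then obtain M where M: "M \<in> carrier_mat d d" "x = B * M * B'" by blast
    obtain A where "A \<in> MM n" "B' * A * B = M" using full[OF M(1)] by blast
    then have "A \<in> MM n" "x = A * U" using mult_U[of A] M(2) by simp_all
    then show "x \<in> I" unfolding I_def by blast
  qed
qed

lemma I_cases:
  assumes "x \<in> I"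
  obtains M where "M \<in> carrier_mat d d" "x = B * M * B'"
  using assms unfolding I_eq by (elim imageE) (rule that)

lemma ideal_I: "ideal I (MM_ring n)"
  using ring.ideal_of_central_element[OF ring_MM_ring, of U n] U_mem U_central
  by (simp add: I_def)

lemma expand_mult:
  assumes "M \<in> carrier_mat d d" "N \<in> carrier_mat d d"
  shows "(B * M * B') * (B * N * B') = B * (M * N) * B'"
  using assms by (simp add: assoc_mult_mat_dim dims cancel)

lemma compress_expand:
  assumes "M \<in> carrier_mat d d"
  shows "B' * (B * M * B') * B = M"
  using assms by (simp add: assoc_mult_mat_dim dims left_inverse cancel)

lemma expand_add:
  assumes "M \<in> carrier_mat d d" "N \<in> carrier_mat d d"
  shows "B * M * B' + B * N * B' = B * (M + N) * B'"
proof -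
  have "B * (M + N) * B' = (B * M + B * N) * B'"
    using assms B by (simp add: mult_add_distrib_mat[of _ n d])
  also have "\<dots> = B * M * B' + B * N * B'"
    using assms B B' by (intro add_mult_distrib_mat[of _ n d _ _ n]) auto
  finally show ?thesis by simp
qed

lemma expand_one: "B * 1\<^sub>m d * B' = U"
  using B by simp

lemma expand_zero: "B * 0\<^sub>m d d * B' = 0\<^sub>m n n"
  using B B' by simp

lemma identity: "ideal_identity U I (MM_ring n)"
proof -
  have "U * x = x \<and> x * U = x" if x: "x \<in> I" for x
  proof -
    obtain M where M: "M \<in> carrier_mat d d" "x = B * M * B'" by (rule I_cases[OF x])
    note one = one_carrier_mat[of d]
    show ?thesis
      using expand_mult[OF one M(1)] expand_mult[OF M(1) one]
      unfolding expand_one left_mult_one_mat[OF M(1)] right_mult_one_mat[OF M(1)] M(2)[symmetric] ..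
  qed
  moreover have "U \<in> I" unfolding I_eq by (rule image_eqI[of _ _ "1\<^sub>m d"]) (simp_all only: expand_one one_carrier_mat)
  ultimately show ?thesis by (simp add: ideal_identity_def)
qed

text \<open>
  Expansion is multiplicative, so the ideals of the algebra inside \<open>I\<close> pull back to two-sided ideals of
  the full matrix algebra.
\<close>
lemma simple: "simple_ideal I (MM_ring n)"
  unfolding simple_ideal_def
proof (intro conjI allI impI)
  show "ideal I (MM_ring n)" by (rule ideal_I)
  have "U \<noteq> 0\<^sub>m n n"
  proof
    assume "U = 0\<^sub>m n n"
    then have "B' * U * B = 0\<^sub>m d d" using B B' by simp
    then have "(1\<^sub>m d :: complex mat) = 0\<^sub>m d d"
      using compress_expand[of "1\<^sub>m d"] by (simp add: expand_one)
    then have "(1\<^sub>m d :: complex mat) $$ (0, 0) = 0" using d by simp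
    then show False using d by simp
  qed
  moreover have "U \<in> I" using identity by (simp add: ideal_identity_def)
  ultimately show "I \<noteq> {\<zero>\<^bsub>MM_ring n\<^esub>}" by auto
next
  fix K assume "ideal K (MM_ring n) \<and> K \<subseteq> I"
  then interpret K: ideal K "MM_ring n" + sub: ring "MM_ring n"
    by (simp_all add: ring_MM_ring)
  have "K \<subseteq> I" using \<open>ideal K (MM_ring n) \<and> K \<subseteq> I\<close> by blast
  show "K = {\<zero>\<^bsub>MM_ring n\<^esub>} \<or> K = I"
  proof (rule disjCI)
    assume "K \<noteq> I"
    define K' where "K' = {M \<in> carrier_mat d d. B * M * B' \<in> K}"
    have "1\<^sub>m d \<notin> K'"
    proof
      assume "1\<^sub>m d \<in> K'"
      then have "U \<in> K" by (simp add: K'_def expand_one)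
      then have "I \<subseteq> K" using K.I_l_closed[of U] by (auto simp: I_def)
      with \<open>K \<subseteq> I\<close> \<open>K \<noteq> I\<close> show False by blast
    qed
    have zero: "M = 0\<^sub>m d d" if "M \<in> K'" for M
    proof (rule ccontr)
      assume "M \<noteq> 0\<^sub>m d d"
      have "1\<^sub>m d \<in> K'"
      proof (rule two_sided_ideal_contains_one[OF _ _ _ _ that \<open>M \<noteq> 0\<^sub>m d d\<close>])
        show "K' \<subseteq> carrier_mat d d" by (auto simp: K'_def)
        show "0\<^sub>m d d \<in> K'" using additive_subgroup.zero_closed[OF K.additive_subgroup_axioms] by (simp add: K'_def expand_zero)
      next
        fix M N assume "M \<in> K'" "N \<in> K'"
        then show "M + N \<in> K'"
          using additive_subgroup.a_closed[OF K.additive_subgroup_axioms, of "B * M * B'" "B * N * B'"] by (auto simp: K'_def expand_add)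
      next
        fix X M Y :: "complex mat"
        assume X: "X \<in> carrier_mat d d" and "M \<in> K'" and Y: "Y \<in> carrier_mat d d"
        then have M: "M \<in> carrier_mat d d" "B * M * B' \<in> K" by (auto simp: K'_def)
        have "(B * X * B') * (B * M * B') \<in> K"
          using K.I_l_closed[OF M(2)] expand_mem[OF X] by simp
        then have "(B * X * B') * (B * M * B') * (B * Y * B') \<in> K"
          using K.I_r_closed expand_mem[OF Y] by simp
        then show "X * M * Y \<in> K'"
          using X M Y by (simp add: K'_def expand_mult)
      qed
      with \<open>1\<^sub>m d \<notin> K'\<close> show False by blast
    qed
    have "x = 0\<^sub>m n n" if x: "x \<in> K" for x
    proof -
      obtain M where M: "M \<in> carrier_mat d d" "x = B * M * B'"
        by (rule I_cases[OF subsetD[OF \<open>K \<subseteq> I\<close> x]])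
      then have "M = 0\<^sub>m d d" using x zero by (simp add: K'_def)
      with M show ?thesis using expand_zero by simp
    qed
    then show "K = {\<zero>\<^bsub>MM_ring n\<^esub>}"
      using additive_subgroup.zero_closed[OF K.additive_subgroup_axioms] unfolding MM_ring_simps by blast
  qed
qed

lemma type: "has_type n I d \<rho>"
  unfolding has_type_def
proof (intro exI[of _ "\<lambda>A. B' * A * B"] conjI ballI allI)
  have I: "A \<in> MM n" if "A \<in> I" for A using that expand_mem by (auto simp: I_eq)
  have Ic: "A \<in> carrier_mat n n" if "A \<in> I" for A using MM_carrier[OF I[OF that]] .
  show "bij_betw (\<lambda>A. B' * A * B) I (carrier_mat d d)"
  proof (rule bij_betw_byWitness[where f' = "\<lambda>M. B * M * B'"])
    show "\<forall>A\<in>I. B * (B' * A * B) * B' = A"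
    proof
      fix A assume A: "A \<in> I"
      have "A * U = A" using identity A by (simp add: ideal_identity_def)
      then show "B * (B' * A * B) * B' = A" using mult_U[OF I[OF A]] by simp
    qed
    show "\<forall>M\<in>carrier_mat d d. B' * (B * M * B') * B = M" using compress_expand by blast
    show "(\<lambda>A. B' * A * B) ` I \<subseteq> carrier_mat d d" using Ic B B' by (auto intro!: mult_carrier_mat)
    show "(\<lambda>M. B * M * B') ` carrier_mat d d \<subseteq> I" by (simp add: I_eq)
  qed
  fix A assume A: "A \<in> I"
  show "B' * (c \<cdot>\<^sub>m A) * B = c \<cdot>\<^sub>m (B' * A * B)" for c
    using Ic[OF A] B B' by (simp add: mult_smult_assoc_mat[of _ d n] mult_smult_distrib[of _ d n])
  show "B' * (A + C) * B = B' * A * B + B' * C * B" if C: "C \<in> I" for C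
    using Ic[OF A] Ic[OF C] B B'
    by (simp add: mult_add_distrib_mat[of _ d n] add_mult_distrib_mat[of _ d n])
  fix g h assume g: "g \<in> carrier (dihedral n)" and "h \<in> carrier (dihedral n)"
  then have h: "inv\<^bsub>dihedral n\<^esub> h \<in> carrier (dihedral n)"
    using group.inv_closed[OF dihedral_group] by blast
  let ?P = "perm_mat n g" and ?Q = "perm_mat n (inv\<^bsub>dihedral n\<^esub> h)"
  have "B' * (?P * A * ?Q) * B = (B' * ?P) * A * (?Q * B)"
    using Ic[OF A] by (simp add: assoc_mult_mat_dim dims carrier_matD[OF perm_mat_carrier])
  also have "\<dots> = \<rho> g * (B' * A * B) * \<rho> (inv\<^bsub>dihedral n\<^esub> h)"
    unfolding left[OF h] right[OF g]
    using Ic[OF A] rep_carrier[OF g] rep_carrier[OF h] by (simp add: assoc_mult_mat_dim dims)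
  finally show "B' * (?P * A * ?Q) * B = \<rho> g * (B' * A * B) * \<rho> (inv\<^bsub>dihedral n\<^esub> h)" .
qed

text \<open>
  A subspace stable under the group is stable under all compressions, and these are all \<open>d \<times> d\<close>
  matrices. Some matrix carries any given nonzero vector to any other vector.
\<close>
lemma irreducible: "irreducible_rep (dihedral n) d \<rho>"
  unfolding irreducible_rep_def
proof (intro conjI allI impI)
  show "0 < d" "representation (dihedral n) d \<rho>" by (fact d rep)+
  fix W assume W: "invariant_subspace (dihedral n) d \<rho> W"
  then have Wc: "v \<in> carrier_vec d" if "v \<in> W" for v
    using that by (auto simp: invariant_subspace_def)
  have stable: "\<forall>v\<in>W. (B' * A * B) *\<^sub>v v \<in> W" if "A \<in> MM n" for A
    using that
  proof (induction rule: MM.induct)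
    case (gen g)
    have "B' * perm_mat n g * B = \<rho> g"
      using rep_carrier[OF gen] by (simp add: right[OF gen] assoc_mult_mat_dim dims left_inverse)
    then show ?case using W gen by (simp add: invariant_subspace_def)
  next
    case (add A C)
    have "B' * (A + C) * B = B' * A * B + B' * C * B"
      using MM_carrier[OF add.hyps(1)] MM_carrier[OF add.hyps(2)] B B'
      by (simp add: mult_add_distrib_mat[of _ d n] add_mult_distrib_mat[of _ d n])
    moreover have "(B' * A * B + B' * C * B) *\<^sub>v v = (B' * A * B) *\<^sub>v v + (B' * C * B) *\<^sub>v v"
      if "v \<in> W" for v
      using MM_carrier[OF add.hyps(1)] MM_carrier[OF add.hyps(2)] B B' Wc[OF that]
      by (intro add_mult_distrib_mat_vec[of _ d d]) (auto intro!: mult_carrier_mat)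
    ultimately show ?case using add.IH W by (simp add: invariant_subspace_def)
  next
    case (smult A c)
    have "B' * (c \<cdot>\<^sub>m A) * B = c \<cdot>\<^sub>m (B' * A * B)"
      using MM_carrier[OF smult.hyps] B B'
      by (simp add: mult_smult_assoc_mat[of _ d n] mult_smult_distrib[of _ d n])
    moreover have "(c \<cdot>\<^sub>m (B' * A * B)) *\<^sub>v v = c \<cdot>\<^sub>v ((B' * A * B) *\<^sub>v v)" if "v \<in> W" for v
      using MM_carrier[OF smult.hyps] B B' Wc[OF that] by (intro eq_vecI) (auto simp: dims)
    ultimately show ?case using smult.IH W by (simp add: invariant_subspace_def)
  next
    case (mult A C)
    note AC = MM_carrier[OF mult.hyps(1)] MM_carrier[OF mult.hyps(2)]
    have "B' * (A * C) * B = B' * A * (C * B)"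
      using AC by (simp add: assoc_mult_mat_dim dims)
    also have "\<dots> = (B' * A * B) * (B' * C * B)"
      unfolding compress_intertwines[OF mult.hyps(2)]
      using AC by (simp add: assoc_mult_mat_dim dims)
    finally have "(B' * (A * C) * B) *\<^sub>v v = (B' * A * B) *\<^sub>v ((B' * C * B) *\<^sub>v v)" if "v \<in> W" for v
      using Wc[OF that] AC B B' by (simp add: assoc_mult_mat_vec[of _ d d _ d])
    with mult.IH show ?case by simp
  qed
  show "W = {0\<^sub>v d} \<or> W = carrier_vec d"
  proof (rule disjCI)
    assume "W \<noteq> carrier_vec d"
    moreover have "W \<subseteq> carrier_vec d" using Wc by blast
    ultimately obtain u where u: "u \<in> carrier_vec d" "u \<notin> W" by blast
    have "w = 0\<^sub>v d" if w: "w \<in> W" for w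
    proof (rule ccontr)
      assume "w \<noteq> 0\<^sub>v d"
      then obtain p where p: "p < d" "w $ p \<noteq> 0"
        using Wc[OF w] by (metis carrier_vecD eq_vecI index_zero_vec)
      let ?M = "mat d d (\<lambda>(i, k). if k = p then u $ i / w $ p else 0)"
      have "?M *\<^sub>v w = u"
      proof (rule eq_vecI)
        fix i assume "i < dim_vec u"
        then have i: "i < d" using u by simp
        have "(?M *\<^sub>v w) $ i = (\<Sum>k = 0..<d. (if k = p then u $ i / w $ p else 0) * w $ k)"
          using i Wc[OF w] by (simp add: scalar_prod_def)
        also have "\<dots> = (\<Sum>k = 0..<d. if k = p then u $ i else 0)"
          using p by (intro sum.cong) auto
        finally show "(?M *\<^sub>v w) $ i = u $ i" using p by simp
      qed (use u in auto)
      moreover obtain A where "A \<in> MM n" "B' * A * B = ?M" using full[of ?M] by auto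
      ultimately have "u \<in> W" using stable w by metis
      with u show False by blast
    qed
    moreover have "0\<^sub>v d \<in> W" using W by (simp add: invariant_subspace_def)
    ultimately show "W = {0\<^sub>v d}" by blast
  qed
qed

lemma corresponds: "corresponds n U d \<rho>"
  unfolding corresponds_def
  by (intro conjI exI[of _ I]) (fact irreducible simple identity type I_def)+

end

text \<open>
  The blocks below come from a real matrix \<open>X\<close> whose rows are orthogonal and of equal norm. Its transpose
  serves as \<open>B\<close> and a multiple of \<open>X\<close> itself as the left inverse.
\<close>
lemma intertwining_blockI:
  assumes X: "X \<in> carrier_mat d n" and d: "0 < d"
    and gram: "c \<cdot>\<^sub>m (X * transpose_mat X) = 1\<^sub>m d"
    and mem: "c \<cdot>\<^sub>m (transpose_mat X * X) \<in> MM n"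
    and rep: "representation (dihedral n) d \<rho>"
    and orth: "\<And>g. g \<in> carrier (dihedral n) \<Longrightarrow> transpose_mat (\<rho> g) * \<rho> g = 1\<^sub>m d"
    and act: "\<And>g. g \<in> carrier (dihedral n) \<Longrightarrow> X * perm_mat n g = \<rho> g * X"
    and full: "\<And>M. M \<in> carrier_mat d d \<Longrightarrow> \<exists>A\<in>MM n. (c \<cdot>\<^sub>m X) * A * transpose_mat X = M"
  shows "intertwining_block n d (transpose_mat X) (c \<cdot>\<^sub>m X) \<rho>"
proof
  show "transpose_mat X \<in> carrier_mat n d" "c \<cdot>\<^sub>m X \<in> carrier_mat d n" using X by auto
  show "c \<cdot>\<^sub>m X * transpose_mat X = 1\<^sub>m d"
    using X gram by (simp add: mult_smult_assoc_mat[of _ d n])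
  show "transpose_mat X * (c \<cdot>\<^sub>m X) \<in> MM n"
    using X mem by (simp add: mult_smult_distrib[of _ n d])
next
  fix g assume g: "g \<in> carrier (dihedral n)"
  have Q: "\<rho> g \<in> carrier_mat d d"
    using rep g by (auto simp: representation_def hom_def units_of_def Units_def ring_mat_simps)
  show "perm_mat n g * transpose_mat X = transpose_mat X * \<rho> g"
    by (rule intertwine_transpose[OF dihedral_permutes[OF g] X Q act[OF g] orth[OF g]])
  show "c \<cdot>\<^sub>m X * perm_mat n g = \<rho> g * (c \<cdot>\<^sub>m X)"
    using mult_smult_assoc_mat[OF X perm_mat_carrier[of n g], of c] mult_smult_distrib[OF Q X, of c]
    by (simp only: act[OF g])
qed (fact d rep full)+

section \<open>The idempotents as circulant matrices\<close>

text \<open>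
  For given \<open>a\<close> and \<open>b\<close> exactly one rotation moves \<open>b\<close> to \<open>a\<close>, so each entry of the sum
  is a single coefficient.
\<close>
lemma rotation_sum:
  fixes w :: "nat \<Rightarrow> complex"
  shows "(\<Oplus>\<^bsub>ring_mat TYPE(complex) n ()\<^esub>k\<in>{0..<n}. w k \<cdot>\<^sub>m perm_mat n (rot_cycle n ^^ k)) =
    mat n n (\<lambda>(a, b). w ((a + n - b) mod n))" (is "?S = ?C")
proof (rule eq_matI)
  interpret R: ring "ring_mat TYPE(complex) n ()" by (rule ring_mat)
  let ?f = "\<lambda>k. w k \<cdot>\<^sub>m perm_mat n (rot_cycle n ^^ k)"
  have "?S \<in> carrier (ring_mat TYPE(complex) n ())"
    by (rule R.finsum_closed) (auto simp: ring_mat_simps)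
  then show "dim_row ?S = dim_row ?C" "dim_col ?S = dim_col ?C" by (auto simp: ring_mat_simps)
  fix a b assume "a < dim_row ?C" "b < dim_col ?C"
  then have a: "a < n" and b: "b < n" by auto
  let ?k = "(a + n - b) mod n"
  have k: "?k = (if b \<le> a then a - b else a + n - b)"
    using a b by (auto simp: mod_if)
  have shift: "(b + k) mod n = a \<longleftrightarrow> k = ?k" if "k < n" for k
    unfolding k using that a b by (auto simp: mod_if)
  have "?S $$ (a, b) = (\<Sum>k\<in>{0..<n}. ?f k $$ (a, b))"
    by (rule finsum_mat_index[OF R.abelian_monoid_axioms]) (use a b in \<open>auto simp: ring_mat_simps\<close>)
  also have "\<dots> = (\<Sum>k\<in>{0..<n}. if k = ?k then w k else 0)"
    using a b by (intro sum.cong) (auto simp: perm_mat_def rot_cycle_pow shift)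
  also have "\<dots> = w ?k" using a by simp
  finally show "?S $$ (a, b) = ?C $$ (a, b)" using a b by simp
qed

lemma rotation_sum_mem:
  "(\<Oplus>\<^bsub>ring_mat TYPE(complex) n ()\<^esub>k\<in>{0..<n}. w k \<cdot>\<^sub>m perm_mat n (rot_cycle n ^^ k)) \<in> MM n"
  by (rule MM_finsum) (auto intro!: MM.smult MM.gen rot_flip_in)

lemma U_triv_mem: "U_triv n \<in> MM n"
proof -
  have "mat n n (\<lambda>(a, b). 1) = (mat n n (\<lambda>_. 1) :: complex mat)" by (intro eq_matI) auto
  then have "mat n n (\<lambda>_. 1) \<in> MM n"
    using rotation_sum_mem[of n "\<lambda>_. 1"] unfolding rotation_sum by simp
  then show ?thesis unfolding U_triv_def by (rule MM.smult)
qed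

lemma U_pi2_mem: "U_pi2 n j \<in> MM n"
  unfolding U_pi2_def by (rule MM.smult[OF rotation_sum_mem])

lemma U_pi2_eq:
  "U_pi2 n j = mat n n (\<lambda>(a, b).
     complex_of_real (2 / real n * cos (2 * (real a - real b) * real j * pi / real n)))"
proof (rule eq_matI)
  let ?C = "mat n n (\<lambda>(a, b).
     complex_of_real (2 / real n * cos (2 * (real a - real b) * real j * pi / real n)))"
  show "dim_row (U_pi2 n j) = dim_row ?C" "dim_col (U_pi2 n j) = dim_col ?C"
    using MM_carrier[OF U_pi2_mem, of n j] by auto
  fix a b assume "a < dim_row ?C" "b < dim_col ?C"
  then have a: "a < n" and b: "b < n" by auto
  \<comment> \<open>Reducing the rotation exponent modulo \<open>n\<close> changes the angle by a multiple of \<open>2 \<pi>\<close>.\<close>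
  have "cos (2 * real ((a + n - b) mod n) * real j * pi / real n) =
      cos (2 * (real a - real b) * real j * pi / real n)"
  proof (cases "b \<le> a")
    case True
    then have "(a + n - b) mod n = a - b" using a by (auto simp: mod_if)
    then show ?thesis using True by (simp add: of_nat_diff)
  next
    case False
    then have "(a + n - b) mod n = a + n - b" using b by (auto simp: mod_if)
    then have "2 * real ((a + n - b) mod n) * real j * pi / real n =
        2 * (real a - real b) * real j * pi / real n + 2 * real j * pi"
      using a b by (simp add: of_nat_diff field_simps)
    then show ?thesis by (simp add: cos_add)
  qed
  then show "U_pi2 n j $$ (a, b) = ?C $$ (a, b)"
    unfolding U_pi2_def rotation_sum using a b by simp
qed

section \<open>The trivial block\<close>

lemma corresponds_triv:
  assumes "0 < n"
  shows "corresponds n (U_triv n) 1 triv_rep"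
proof -
  let ?X = "mat 1 n (\<lambda>_. 1) :: complex mat" and ?c = "1 / of_nat n :: complex"
  have gram: "?c \<cdot>\<^sub>m (?X * transpose_mat ?X) = 1\<^sub>m 1"
    using assms by (intro eq_matI) (auto simp: scalar_prod_def)
  have U: "?c \<cdot>\<^sub>m (transpose_mat ?X * ?X) = U_triv n"
    unfolding U_triv_def by (intro eq_matI) (auto simp: scalar_prod_def)
  have "intertwining_block n 1 (transpose_mat ?X) (?c \<cdot>\<^sub>m ?X) triv_rep"
  proof (rule intertwining_blockI[OF _ _ gram])
    show "?c \<cdot>\<^sub>m (transpose_mat ?X * ?X) \<in> MM n" unfolding U by (rule U_triv_mem)
    show "representation (dihedral n) 1 triv_rep"
      by (auto simp: representation_def hom_def units_of_def Units_def ring_mat_simps triv_rep_def)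
  next
    fix g assume "g \<in> carrier (dihedral n)"
    then have g: "g permutes {1..n}" by (rule dihedral_permutes)
    show "transpose_mat (triv_rep g) * triv_rep g = 1\<^sub>m 1" by (simp add: triv_rep_def)
    have "?X * perm_mat n g = ?X"
    proof (rule eq_matI)
      fix c i assume "c < dim_row ?X" "i < dim_col ?X"
      then have ci: "c < 1" "i < n" by auto
      have "g (i + 1) \<in> {1..n}" using permutes_in_image[OF g, of "i + 1"] ci by simp
      then obtain m where "g (i + 1) = m + 1" "m < n" by (cases "g (i + 1)") auto
      then show "(?X * perm_mat n g) $$ (c, i) = ?X $$ (c, i)"
        using mult_perm_mat_index[of ?X 1 n c i g] ci g by simp
    qed auto
    then show "?X * perm_mat n g = triv_rep g * ?X" by (simp add: triv_rep_def)
  next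
    fix M :: "complex mat" assume M: "M \<in> carrier_mat 1 1"
    have X: "?X \<in> carrier_mat 1 n" and cX: "?c \<cdot>\<^sub>m ?X \<in> carrier_mat 1 n"
      and T: "transpose_mat ?X \<in> carrier_mat n 1" by simp_all
    have "?c \<cdot>\<^sub>m ?X * (M $$ (0, 0) \<cdot>\<^sub>m 1\<^sub>m n) * transpose_mat ?X = M $$ (0, 0) \<cdot>\<^sub>m (?c \<cdot>\<^sub>m (?X * transpose_mat ?X))"
      unfolding mult_smult_distrib[OF cX one_carrier_mat] right_mult_one_mat[OF cX]
        mult_smult_assoc_mat[OF cX T] mult_smult_assoc_mat[OF X T] ..
    also have "\<dots> = M" unfolding gram using M by (intro eq_matI) auto
    finally show "\<exists>A\<in>MM n. ?c \<cdot>\<^sub>m ?X * A * transpose_mat ?X = M"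
      using MM.smult[OF MM_one] by blast
  qed auto
  from intertwining_block.corresponds[OF this] show ?thesis
    using mult_smult_distrib[of "transpose_mat ?X" n 1 ?X n ?c] unfolding U by simp
qed

section \<open>The two-dimensional blocks\<close>

lemma below_2: "(0 :: nat) < 2" "(1 :: nat) < 2"
  by simp_all

lemma mult2_index:
  assumes "A \<in> carrier_mat d 2" "X \<in> carrier_mat 2 m" "c < d" "i < m"
  shows "(A * X) $$ (c, i) = A $$ (c, 0) * X $$ (0, i) + A $$ (c, 1) * X $$ (1, i)"
  using assms by (simp add: scalar_prod_def numeral_2_eq_2)

lemma rot_mat_index:
  "rot_mat t $$ (0, 0) = complex_of_real (cos t)" "rot_mat t $$ (0, 1) = - complex_of_real (sin t)"
  "rot_mat t $$ (1, 0) = complex_of_real (sin t)" "rot_mat t $$ (1, 1) = complex_of_real (cos t)"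
  by (simp_all add: rot_mat_def mat_of_rows_list_def)

lemma refl_mat_index:
  "refl_mat $$ (0, 0) = 1" "refl_mat $$ (0, 1) = 0" "refl_mat $$ (1, 0) = 0" "refl_mat $$ (1, 1) = - 1"
  by (simp_all add: refl_mat_def mat_of_rows_list_def)

lemma refl_rot_carrier [simp]: "refl_mat * rot_mat t \<in> carrier_mat 2 2"
  by (rule mult_carrier_mat[of _ 2 2]) simp_all

lemma refl_rot_index:
  "(refl_mat * rot_mat t) $$ (0, 0) = complex_of_real (cos t)"
  "(refl_mat * rot_mat t) $$ (0, 1) = - complex_of_real (sin t)"
  "(refl_mat * rot_mat t) $$ (1, 0) = - complex_of_real (sin t)"
  "(refl_mat * rot_mat t) $$ (1, 1) = - complex_of_real (cos t)"
  by (simp_all only: mult2_index[OF rot_mat_carrier(2) rot_mat_carrier(1)] below_2 rot_mat_index refl_mat_index)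
    simp_all

lemma orthogonal2I:
  assumes A: "A \<in> carrier_mat 2 2"
    and "A $$ (0, 0) * A $$ (0, 0) + A $$ (1, 0) * A $$ (1, 0) = 1"
    and "A $$ (0, 1) * A $$ (0, 1) + A $$ (1, 1) * A $$ (1, 1) = 1"
    and "A $$ (0, 0) * A $$ (0, 1) + A $$ (1, 0) * A $$ (1, 1) = 0"
  shows "transpose_mat A * A = (1\<^sub>m 2 :: complex mat)"
proof -
  have T: "transpose_mat A \<in> carrier_mat 2 2" using A by simp
  note ix = mult2_index[OF T A]
  have t: "transpose_mat A $$ (i, k) = A $$ (k, i)" if "i < 2" "k < 2" for i k
    using A that by simp
  show ?thesis
    by (rule mat2_eqI)
      (use T A assms(2-4) in \<open>simp_all only: ix t mult_carrier_mat one_carrier_mat, simp_all add: mult.commute\<close>)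
qed

lemma rot_orthogonal: "transpose_mat (rot_mat t) * rot_mat t = 1\<^sub>m 2"
  by (rule orthogonal2I) (simp_all only: rot_mat_carrier rot_mat_index,
    simp_all add: sin_cos_squared_add3 add.commute flip: of_real_mult of_real_add)

lemma refl_rot_orthogonal:
  "transpose_mat (refl_mat * rot_mat t) * (refl_mat * rot_mat t) = 1\<^sub>m 2"
  by (rule orthogonal2I) (simp_all only: refl_rot_carrier refl_rot_index,
    simp_all add: sin_cos_squared_add3 add.commute flip: of_real_mult of_real_add)

text \<open>
  The argument is measured from the midpoint \<open>(n - 1) / 2\<close> of the indices \<open>0, \<dots>, n - 1\<close>, so that the
  flip, which sends \<open>a\<close> to \<open>n - 1 - a\<close>, changes its sign.
\<close>
definition phase :: "nat \<Rightarrow> nat \<Rightarrow> nat \<Rightarrow> real" where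
  "phase n j a = 2 * real j * pi * (real a - (real n - 1) / 2) / real n"

definition wave :: "nat \<Rightarrow> nat \<Rightarrow> complex mat" where
  "wave n j = mat 2 n (\<lambda>(c, a). complex_of_real (if c = 0 then cos (phase n j a) else sin (phase n j a)))"

lemma wave_carrier [simp]: "wave n j \<in> carrier_mat 2 n"
  by (simp add: wave_def)

lemma wave_index:
  assumes "a < n"
  shows "wave n j $$ (0, a) = complex_of_real (cos (phase n j a))"
    and "wave n j $$ (1, a) = complex_of_real (sin (phase n j a))"
  using assms by (simp_all add: wave_def)

lemma phase_add:
  "0 < n \<Longrightarrow> phase n j (a + k) = phase n j a + 2 * pi * real (j * k) / real n"
  by (simp add: phase_def field_simps)

lemma phase_mod:
  assumes "0 < n"
  shows "cos (phase n j (m mod n)) = cos (phase n j m)" "sin (phase n j (m mod n)) = sin (phase n j m)"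
proof -
  have "phase n j m = phase n j (m mod n + n * (m div n))" by simp
  also have "\<dots> = phase n j (m mod n) + 2 * pi * real (j * (m div n))"
    unfolding phase_add[OF assms] using assms by simp
  also have "\<dots> = phase n j (m mod n) + 2 * real (j * (m div n)) * pi" by simp
  finally have *: "phase n j m = phase n j (m mod n) + 2 * real (j * (m div n)) * pi" .
  show "cos (phase n j (m mod n)) = cos (phase n j m)" "sin (phase n j (m mod n)) = sin (phase n j m)"
    unfolding * cos_add sin_add cos_2npi sin_2npi by simp_all
qed

lemma phase_reflect:
  assumes "a < n"
  shows "phase n j (n - 1 - a) = - phase n j a"
proof -
  have "real (n - 1 - a) = real n - 1 - real a" using assms by (simp add: of_nat_diff)
  then show ?thesis using assms by (simp add: phase_def field_simps)
qed

text \<open>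
  A rotation shifts the phase, so the addition theorems express the shifted waves by the rotation
  matrix; the flip negates the phase, which is the reflection across the first axis.
\<close>
lemma wave_action:
  assumes n: "3 \<le> n" and g: "g \<in> carrier (dihedral n)"
  shows "wave n j * perm_mat n g = pi2 n (phi n j g) * wave n j"
proof -
  have n0: "0 < n" using n by simp
  note perm = dihedral_permutes[OF g]
  have ext: "wave n j * perm_mat n g = Q * wave n j"
    if Q: "Q \<in> carrier_mat 2 2"
      and 0: "\<And>i. i < n \<Longrightarrow> wave n j $$ (0, g (i + 1) - 1) = Q $$ (0, 0) * wave n j $$ (0, i) + Q $$ (0, 1) * wave n j $$ (1, i)"
      and 1: "\<And>i. i < n \<Longrightarrow> wave n j $$ (1, g (i + 1) - 1) = Q $$ (1, 0) * wave n j $$ (0, i) + Q $$ (1, 1) * wave n j $$ (1, i)"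
    for Q
  proof (rule eq_matI)
    fix c i assume "c < dim_row (Q * wave n j)" "i < dim_col (Q * wave n j)"
    then have ci: "c < 2" "i < n" using Q by (auto simp: wave_def)
    have "c = 0 \<or> c = 1" using ci by auto
    then show "(wave n j * perm_mat n g) $$ (c, i) = (Q * wave n j) $$ (c, i)"
      unfolding mult_perm_mat_index[OF wave_carrier ci perm] mult2_index[OF Q wave_carrier ci]
      using 0[OF ci(2)] 1[OF ci(2)] by blast
  qed (use Q in \<open>auto simp: wave_def\<close>)
  from dihedral_cases[OF n0 g] show ?thesis
  proof cases
    case (1 k)
    let ?t = "2 * pi * real (j * k) / real n"
    have Q: "pi2 n (phi n j g) = rot_mat ?t" by (simp add: 1 phi_rot[OF n] pi2_rot[OF n])
    have img: "g (i + 1) - 1 = (i + k) mod n" if "i < n" for i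
      using that by (simp add: 1 rot_cycle_pow)
    show ?thesis
      unfolding Q
      by (rule ext)
        (simp_all only: rot_mat_carrier img, simp_all only: rot_mat_index wave_index mod_less_divisor[OF n0]
          phase_mod[OF n0] phase_add[OF n0] cos_add sin_add, simp_all add: algebra_simps)
  next
    case (2 k)
    let ?t = "2 * pi * real (j * k) / real n"
    have Q: "pi2 n (phi n j g) = refl_mat * rot_mat ?t" by (simp add: 2 phi_flip[OF n] pi2_flip[OF n])
    have img: "g (i + 1) - 1 = n - 1 - (i + k) mod n" if "i < n" for i
    proof -
      have "g (i + 1) = flip n ((i + k) mod n + 1)" using that by (simp add: 2 rot_cycle_pow)
      moreover have "flip n (m + 1) = n - m" if "m < n" for m using that by (simp add: flip_def)
      ultimately show ?thesis using mod_less_divisor[OF n0] by simp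
    qed
    have less: "n - 1 - m < n" for m using n0 by simp
    show ?thesis
      unfolding Q
      by (rule ext)
        (simp_all only: refl_rot_carrier img, simp_all only: refl_rot_index wave_index less mod_less_divisor[OF n0]
          phase_reflect cos_minus sin_minus phase_mod[OF n0] phase_add[OF n0] cos_add sin_add,
         simp_all add: algebra_simps)
  qed
qed

lemma pi2_phi_orthogonal:
  assumes n: "3 \<le> n" and g: "g \<in> carrier (dihedral n)"
  shows "transpose_mat (pi2 n (phi n j g)) * pi2 n (phi n j g) = 1\<^sub>m 2"
proof -
  have n0: "0 < n" using n by simp
  from dihedral_cases[OF n0 g] show ?thesis
    by cases (simp_all only: phi_rot[OF n] phi_flip[OF n] pi2_rot[OF n] pi2_flip[OF n]
        rot_orthogonal refl_rot_orthogonal)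
qed

lemma pi2_phi_representation:
  assumes "3 \<le> n"
  shows "representation (dihedral n) 2 (pi2 n \<circ> phi n j)"
  using hom_compose[OF phi_hom(1)[OF assms] pi2_representation(1)[OF assms, unfolded representation_def]]
  unfolding representation_def .

lemma pi2_phi_carrier:
  assumes "3 \<le> n" "g \<in> carrier (dihedral n)"
  shows "pi2 n (phi n j g) \<in> carrier_mat 2 2"
  using pi2_phi_representation[OF assms(1), of j] assms(2)
  by (auto simp: representation_def hom_def units_of_def Units_def ring_mat_simps)

lemma sin_rotation_angle_pos:
  assumes "j \<in> {1..(n - 1) div 2}"
  shows "0 < sin (2 * pi * real j / real n)"
proof (rule sin_gt_zero)
  have j: "0 < j" "2 * j < n" using assms by auto
  then show "0 < 2 * pi * real j / real n" by simp
  have "2 * real j < real n" using j by (metis of_nat_less_iff of_nat_mult of_nat_numeral)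
  then have "pi * (2 * real j) < pi * real n" by simp
  then show "2 * pi * real j / real n < pi" using j by (simp add: field_simps)
qed

text \<open>
  This is Schur's lemma for the two-dimensional representation, made explicit: commuting with the
  reflection makes \<open>G\<close> diagonal, and commuting with a proper rotation makes its diagonal entries equal.
\<close>
lemma scalar_of_commute:
  assumes G: "G \<in> carrier_mat 2 2" and s: "sin t \<noteq> 0"
    and refl: "refl_mat * G = G * refl_mat" and rot: "rot_mat t * G = G * rot_mat t"
  shows "G $$ (0, 1) = 0" "G $$ (1, 0) = 0" "G $$ (1, 1) = G $$ (0, 0)"
proof -
  note ix = mult2_index[OF _ G, of _ 2] mult2_index[OF G, of _ 2]
  have "(refl_mat * G) $$ (0, 1) = (G * refl_mat) $$ (0, 1)" by (simp only: refl)
  then show 01: "G $$ (0, 1) = 0" using eq_neg_iff_add_eq_0 by (simp add: ix refl_mat_index[simplified])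
  have "(refl_mat * G) $$ (1, 0) = (G * refl_mat) $$ (1, 0)" by (simp only: refl)
  then show 10: "G $$ (1, 0) = 0" by (simp add: ix refl_mat_index[simplified])
  have "(rot_mat t * G) $$ (0, 1) = (G * rot_mat t) $$ (0, 1)" by (simp only: rot)
  then show "G $$ (1, 1) = G $$ (0, 0)" using s 01 by (simp add: ix rot_mat_index[simplified])
qed

text \<open>
  The Gram matrix of the waves commutes with the representation and hence is scalar. Its trace is
  the sum of \<open>cos\<^sup>2 + sin\<^sup>2\<close> over \<open>n\<close> points, so the scalar is \<open>n / 2\<close>. This
  avoids evaluating trigonometric sums.
\<close>
lemma wave_gram:
  assumes n: "3 \<le> n" and j: "j \<in> {1..(n - 1) div 2}"
  shows "(2 / of_nat n) \<cdot>\<^sub>m (wave n j * transpose_mat (wave n j)) = 1\<^sub>m 2"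
proof -
  let ?X = "wave n j" and ?T = "transpose_mat (wave n j)"
  let ?G = "?X * ?T"
  have n0: "0 < n" using n by simp
  have T: "?T \<in> carrier_mat n 2" by simp
  have G: "?G \<in> carrier_mat 2 2" by (rule mult_carrier_mat[OF wave_carrier T])
  have comm: "pi2 n (phi n j g) * ?G = ?G * pi2 n (phi n j g)" if g: "g \<in> carrier (dihedral n)" for g
  proof -
    note Q = pi2_phi_carrier[OF n g, of j] and act = wave_action[OF n g, of j]
    have "pi2 n (phi n j g) * ?G = ?X * perm_mat n g * ?T"
      unfolding act by (rule assoc_mult_mat[OF Q wave_carrier T, symmetric])
    also have "\<dots> = ?X * (perm_mat n g * ?T)"
      by (rule assoc_mult_mat[OF wave_carrier perm_mat_carrier T])
    also have "\<dots> = ?X * (?T * pi2 n (phi n j g))"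
      by (simp only: intertwine_transpose[OF dihedral_permutes[OF g] wave_carrier Q act pi2_phi_orthogonal[OF n g]])
    also have "\<dots> = ?G * pi2 n (phi n j g)"
      by (rule assoc_mult_mat[OF wave_carrier T Q, symmetric])
    finally show ?thesis .
  qed
  let ?t = "2 * pi * real j / real n"
  have "sin ?t \<noteq> 0" using sin_rotation_angle_pos[OF j] by simp
  moreover have "refl_mat * ?G = ?G * refl_mat"
    using comm[OF rot_flip_in(2)[OF n0, of 0]]
    by (simp add: phi_hom(3)[OF n] pi2_representation(3)[OF n])
  moreover have "rot_mat ?t * ?G = ?G * rot_mat ?t"
    using comm[OF rot_flip_in(1)[OF n0, of 1]]
    unfolding phi_rot[OF n] pi2_rot[OF n] by simp
  ultimately have e: "?G $$ (0, 1) = 0" "?G $$ (1, 0) = 0" "?G $$ (1, 1) = ?G $$ (0, 0)"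
    using scalar_of_commute[OF G] by blast+
  have diag: "?G $$ (c, c) = (\<Sum>a = 0..<n. ?X $$ (c, a) * ?X $$ (c, a))" if "c < 2" for c
    using that by (simp add: scalar_prod_def wave_def)
  have "?G $$ (0, 0) + ?G $$ (1, 1) = (\<Sum>a = 0..<n. ?X $$ (0, a) * ?X $$ (0, a) + ?X $$ (1, a) * ?X $$ (1, a))"
    by (simp only: diag below_2 sum.distrib)
  also have "\<dots> = (\<Sum>a = 0..<n. 1)"
    by (intro sum.cong refl) (simp only: atLeastLessThan_iff wave_index,
      simp add: sin_cos_squared_add3 flip: of_real_mult of_real_add)
  finally have "?G $$ (0, 0) + ?G $$ (1, 1) = of_nat n" by simp
  then have tr: "2 * ?G $$ (0, 0) = of_nat n" using e(3) by simp
  have sc: "((2 / of_nat n) \<cdot>\<^sub>m ?G) $$ (a, b) = (2 / of_nat n) * ?G $$ (a, b)" if "a < 2" "b < 2" for a b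
    using that by (simp add: wave_def)
  show ?thesis
  proof (rule mat2_eqI)
    show "(2 / of_nat n) \<cdot>\<^sub>m ?G \<in> carrier_mat 2 2" using G by simp
  qed (simp_all only: sc e below_2,
      use tr n0 in \<open>simp_all add: field_simps\<close>)
qed

text \<open>
  The entries reduce to \<open>cos (x - y) = cos x cos y + sin x sin y\<close>.
\<close>
lemma wave_projection: "(2 / of_nat n) \<cdot>\<^sub>m (transpose_mat (wave n j) * wave n j) = U_pi2 n j"
proof (rule eq_matI)
  have T: "transpose_mat (wave n j) \<in> carrier_mat n 2" by simp
  fix a b assume "a < dim_row (U_pi2 n j)" "b < dim_col (U_pi2 n j)"
  then have a: "a < n" and b: "b < n" by (simp_all add: U_pi2_eq)
  have "phase n j a - phase n j b = 2 * (real a - real b) * real j * pi / real n"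
    using a by (simp add: phase_def field_simps)
  moreover have "(transpose_mat (wave n j) * wave n j) $$ (a, b) = complex_of_real (cos (phase n j a - phase n j b))"
    unfolding mult2_index[OF T wave_carrier a b] cos_diff
    using a b wave_index[OF a] wave_index[OF b] by (simp add: carrier_matD[OF wave_carrier])
  ultimately show "((2 / of_nat n) \<cdot>\<^sub>m (transpose_mat (wave n j) * wave n j)) $$ (a, b) = U_pi2 n j $$ (a, b)"
    unfolding U_pi2_eq using a b by (simp add: carrier_matD[OF wave_carrier])
qed (simp_all add: U_pi2_eq carrier_matD[OF wave_carrier])

text \<open>
  On the diagonal the identity and the reflection give two independent directions; off the
  diagonal the rotation and the rotated reflection do, because the sine does not vanish.
\<close>
lemma mat2_as_dihedral_combination:
  assumes M: "M \<in> carrier_mat 2 2" and s: "sin t \<noteq> 0"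
  shows "\<exists>a b c e. M = a \<cdot>\<^sub>m 1\<^sub>m 2 + b \<cdot>\<^sub>m refl_mat + c \<cdot>\<^sub>m rot_mat t + e \<cdot>\<^sub>m (refl_mat * rot_mat t)"
proof -
  define p q r u where "p = M $$ (0, 0)" and "q = M $$ (0, 1)" and "r = M $$ (1, 0)" and "u = M $$ (1, 1)"
  define S C where "S = complex_of_real (sin t)" and "C = complex_of_real (cos t)"
  have S: "S \<noteq> 0" using s by (simp add: S_def)
  \<comment> \<open>The off-diagonal entries fix \<open>c + e\<close> and \<open>c - e\<close>; the diagonal ones then fix \<open>a + b\<close> and \<open>a - b\<close>.\<close>
  define a b c e where "a = ((p + q * C / S) + (u - r * C / S)) / 2"
    and "b = ((p + q * C / S) - (u - r * C / S)) / 2"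
    and "c = (r / S - q / S) / 2" and "e = (- r / S - q / S) / 2"
  have ab: "a + b = p + q * C / S" "a - b = u - r * C / S" "c + e = - q / S" "c - e = r / S"
    unfolding a_def b_def c_def e_def by (simp_all add: field_simps)
  have d: "dim_row refl_mat = 2" "dim_col refl_mat = 2" "dim_row (rot_mat t) = 2" "dim_col (rot_mat t) = 2"
    using carrier_matD[OF rot_mat_carrier(2)] carrier_matD[OF rot_mat_carrier(1)] by auto
  let ?N = "a \<cdot>\<^sub>m 1\<^sub>m 2 + b \<cdot>\<^sub>m refl_mat + c \<cdot>\<^sub>m rot_mat t + e \<cdot>\<^sub>m (refl_mat * rot_mat t)"
  have N: "?N $$ (i, k) = a * 1\<^sub>m 2 $$ (i, k) + b * refl_mat $$ (i, k) + c * rot_mat t $$ (i, k)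
      + e * (refl_mat * rot_mat t) $$ (i, k)" if "i < 2" "k < 2" for i k
    using that by (simp add: d del: index_mult_mat(1))
  have Nc: "?N \<in> carrier_mat 2 2" by (simp add: d)
  have "M = ?N"
  proof (rule mat2_eqI[OF M Nc])
    have "?N $$ (0, 0) = (a + b) + (c + e) * C"
      by (simp only: N below_2 refl_mat_index rot_mat_index refl_rot_index C_def) (simp add: algebra_simps)
    also have "\<dots> = p" unfolding ab using S by simp
    finally show "M $$ (0, 0) = ?N $$ (0, 0)" unfolding p_def ..
    have "?N $$ (0, 1) = - (c + e) * S"
      by (simp only: N below_2 refl_mat_index rot_mat_index refl_rot_index S_def) (simp add: algebra_simps)
    also have "\<dots> = q" unfolding ab using S by simp
    finally show "M $$ (0, 1) = ?N $$ (0, 1)" unfolding q_def ..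
    have "?N $$ (1, 0) = (c - e) * S"
      by (simp only: N below_2 refl_mat_index rot_mat_index refl_rot_index S_def) (simp add: algebra_simps)
    also have "\<dots> = r" unfolding ab using S by simp
    finally show "M $$ (1, 0) = ?N $$ (1, 0)" unfolding r_def ..
    have "?N $$ (1, 1) = (a - b) + (c - e) * C"
      by (simp only: N below_2 refl_mat_index rot_mat_index refl_rot_index C_def) (simp add: algebra_simps)
    also have "\<dots> = u" unfolding ab using S by simp
    finally show "M $$ (1, 1) = ?N $$ (1, 1)" unfolding u_def ..
  qed
  then show ?thesis by blast
qed

lemma corresponds_pi2:
  assumes n: "3 \<le> n" and j: "j \<in> {1..(n - 1) div 2}"
  shows "corresponds n (U_pi2 n j) 2 (pi2 n \<circ> phi n j)"
proof -
  let ?X = "wave n j" and ?T = "transpose_mat (wave n j)" and ?c = "2 / of_nat n :: complex"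
  let ?F = "\<lambda>A. ?c \<cdot>\<^sub>m ?X * A * ?T"
  have n0: "0 < n" using n by simp
  have cX: "?c \<cdot>\<^sub>m ?X \<in> carrier_mat 2 n" and T: "?T \<in> carrier_mat n 2" by simp_all
  have F_add: "?F (A + A') = ?F A + ?F A'" if "A \<in> MM n" "A' \<in> MM n" for A A'
    unfolding mult_add_distrib_mat[OF cX MM_carrier[OF that(1)] MM_carrier[OF that(2)]]
    by (rule add_mult_distrib_mat[OF mult_carrier_mat[OF cX MM_carrier[OF that(1)]]
          mult_carrier_mat[OF cX MM_carrier[OF that(2)]] T])
  have F_smult: "?F (c \<cdot>\<^sub>m A) = c \<cdot>\<^sub>m ?F A" if "A \<in> MM n" for c A
    unfolding mult_smult_distrib[OF cX MM_carrier[OF that]]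
    by (rule mult_smult_assoc_mat[OF mult_carrier_mat[OF cX MM_carrier[OF that]] T])
  have F_perm: "?F (perm_mat n g) = pi2 n (phi n j g)" if g: "g \<in> carrier (dihedral n)" for g
  proof -
    note Q = pi2_phi_carrier[OF n g, of j]
    have "?F (perm_mat n g) = ?c \<cdot>\<^sub>m (?X * perm_mat n g * ?T)"
      unfolding mult_smult_assoc_mat[OF wave_carrier perm_mat_carrier]
      by (rule mult_smult_assoc_mat[OF mult_carrier_mat[OF wave_carrier perm_mat_carrier] T])
    also have "\<dots> = ?c \<cdot>\<^sub>m (pi2 n (phi n j g) * (?X * ?T))"
      unfolding wave_action[OF n g] assoc_mult_mat[OF Q wave_carrier T] ..
    also have "\<dots> = pi2 n (phi n j g) * (?c \<cdot>\<^sub>m (?X * ?T))"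
      by (rule mult_smult_distrib[OF Q mult_carrier_mat[OF wave_carrier T], symmetric])
    also have "\<dots> = pi2 n (phi n j g)"
      unfolding wave_gram[OF n j] by (rule right_mult_one_mat[OF Q])
    finally show ?thesis .
  qed
  let ?t = "2 * pi * real j / real n"
  let ?R = "rot_cycle n ^^ 1" and ?C = "flip n \<circ> rot_cycle n ^^ 0" and ?CR = "flip n \<circ> rot_cycle n ^^ 1"
  have img: "pi2 n (phi n j id) = 1\<^sub>m 2" "pi2 n (phi n j ?C) = refl_mat"
    "pi2 n (phi n j ?R) = rot_mat ?t" "pi2 n (phi n j ?CR) = refl_mat * rot_mat ?t"
    using phi_rot[OF n, of j 0] pi2_rot[OF n, of 0] phi_hom(3)[OF n] pi2_representation(3)[OF n]
    by (simp_all only: phi_rot[OF n] phi_flip[OF n] pi2_rot[OF n] pi2_flip[OF n] mult_1_right funpow.simps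
        comp_id mult_0_right) (simp_all add: rot_mat_0)
  have mem: "perm_mat n id \<in> MM n" "perm_mat n ?C \<in> MM n" "perm_mat n ?R \<in> MM n" "perm_mat n ?CR \<in> MM n"
    using rot_flip_in[OF n0] dihedral_one by (auto intro!: MM.gen simp del: funpow.simps)
  have "intertwining_block n 2 ?T (?c \<cdot>\<^sub>m ?X) (pi2 n \<circ> phi n j)"
  proof (rule intertwining_blockI[OF wave_carrier _ wave_gram[OF n j] _ pi2_phi_representation[OF n]])
    show "?c \<cdot>\<^sub>m (?T * ?X) \<in> MM n" unfolding wave_projection by (rule U_pi2_mem)
  next
    fix g assume g: "g \<in> carrier (dihedral n)"
    show "transpose_mat ((pi2 n \<circ> phi n j) g) * (pi2 n \<circ> phi n j) g = 1\<^sub>m 2"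
      using pi2_phi_orthogonal[OF n g] by simp
    show "?X * perm_mat n g = (pi2 n \<circ> phi n j) g * ?X" using wave_action[OF n g] by simp
  next
    fix M :: "complex mat" assume M: "M \<in> carrier_mat 2 2"
    have "sin ?t \<noteq> 0" using sin_rotation_angle_pos[OF j] by simp
    then obtain a b c e where Meq: "M = a \<cdot>\<^sub>m 1\<^sub>m 2 + b \<cdot>\<^sub>m refl_mat + c \<cdot>\<^sub>m rot_mat ?t + e \<cdot>\<^sub>m (refl_mat * rot_mat ?t)"
      using mat2_as_dihedral_combination[OF M] by blast
    let ?A = "a \<cdot>\<^sub>m perm_mat n id + b \<cdot>\<^sub>m perm_mat n ?C + c \<cdot>\<^sub>m perm_mat n ?R + e \<cdot>\<^sub>m perm_mat n ?CR"
    note m1 = MM.smult[OF mem(1), of a] and m2 = MM.smult[OF mem(2), of b]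
      and m3 = MM.smult[OF mem(3), of c] and m4 = MM.smult[OF mem(4), of e]
    have "?F ?A = M"
      unfolding F_add[OF MM.add[OF MM.add[OF m1 m2] m3] m4] F_add[OF MM.add[OF m1 m2] m3] F_add[OF m1 m2]
        F_smult[OF mem(1)] F_smult[OF mem(2)] F_smult[OF mem(3)] F_smult[OF mem(4)]
        F_perm[OF dihedral_one] F_perm[OF rot_flip_in(1)[OF n0]] F_perm[OF rot_flip_in(2)[OF n0]]
        img Meq ..
    then show "\<exists>A\<in>MM n. ?F A = M" by (rule bexI) (intro MM.add m1 m2 m3 m4)
  qed simp
  from intertwining_block.corresponds[OF this] show ?thesis
    unfolding mult_smult_distrib[OF T wave_carrier] wave_projection .
qed

section \<open>The blocks exhaust the algebra\<close>

text \<open>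
  The sum telescopes after multiplication by \<open>2 sin (x / 2)\<close>, as
  \<open>2 sin (x / 2) cos (j x) = sin ((j + 1 / 2) x) - sin ((j - 1 / 2) x)\<close>.
\<close>
lemma dirichlet_kernel:
  fixes x :: real
  shows "sin (x / 2) * (1 + 2 * (\<Sum>j = 1..N. cos (real j * x))) = sin ((real N + 1 / 2) * x)"
proof (induction N)
  case (Suc N)
  have "2 * sin (x / 2) * cos (real (Suc N) * x) = sin ((real (Suc N) + 1 / 2) * x) - sin ((real N + 1 / 2) * x)"
  proof -
    have "(real (Suc N) + 1 / 2) * x = real (Suc N) * x + x / 2" "(real N + 1 / 2) * x = real (Suc N) * x - x / 2"
      by (simp_all add: algebra_simps)
    then show ?thesis by (simp only: sin_add sin_diff) simp
  qed
  with Suc show ?case by (simp add: algebra_simps)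
qed simp

text \<open>
  With \<open>N = (n - 1) / 2\<close> frequencies and \<open>x = 2 \<pi> (a - b) / n\<close>, the numerator of the Dirichlet kernel
  is \<open>sin ((N + 1 / 2) x) = sin (\<pi> (a - b)) = 0\<close>. The equation \<open>N + 1 / 2 = n / 2\<close> is where oddness of
  \<open>n\<close> is used, and \<open>|a - b| < n\<close> keeps the denominator nonzero off the diagonal.
\<close>
lemma cosine_sum:
  assumes "odd n" "a < n" "b < n"
  shows "1 + 2 * (\<Sum>j = 1..(n - 1) div 2. cos (2 * (real a - real b) * real j * pi / real n)) =
    (if a = b then real n else 0)"
proof (cases "a = b")
  case True
  have "2 * ((n - 1) div 2) = n - 1" using assms(1) by simp
  then have "2 * real ((n - 1) div 2) = real n - 1" using assms by (metis Suc_leI less_nat_zero_code linorder_neqE_nat of_nat_1 of_nat_diff of_nat_mult of_nat_numeral One_nat_def)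
  then show ?thesis using True by simp
next
  case False
  define x where "x = 2 * ((real a - real b) * pi / real n)"
  have n0: "real n \<noteq> 0" using assms by simp
  have "sin (x / 2) \<noteq> 0"
  proof
    assume "sin (x / 2) = 0"
    then obtain i :: int where "x / 2 = of_int i * pi" unfolding sin_zero_iff_int2 by blast
    moreover have "x / 2 = (real a - real b) * pi / real n" by (simp add: x_def)
    ultimately have "(real a - real b) * pi = (of_int i * real n) * pi"
      using n0 by (simp add: divide_eq_eq mult_ac)
    then have "real a - real b = of_int i * real n" unfolding mult_right_cancel[OF pi_neq_zero] .
    then have "of_int (int a - int b) = (of_int (i * int n) :: real)" by simp
    then have "int a - int b = i * int n" by (simp only: of_int_eq_iff)
    moreover have "\<bar>int a - int b\<bar> < int n" using assms by linarith
    ultimately have "int a - int b = 0"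
      using dvd_imp_le_int[of "int a - int b" "int n"] by force
    with False show False by simp
  qed
  moreover have "sin ((real ((n - 1) div 2) + 1 / 2) * x) = 0"
  proof -
    have "2 * ((n - 1) div 2) + 1 = n" using assms(1) by (auto elim: oddE)
    then have "2 * real ((n - 1) div 2) + 1 = real n" by (metis of_nat_1 of_nat_add of_nat_mult of_nat_numeral)
    then have half: "real ((n - 1) div 2) + 1 / 2 = real n / 2" by simp
    have "(real ((n - 1) div 2) + 1 / 2) * x = of_int (int a - int b) * pi"
      unfolding half using n0 by (simp add: x_def)
    then show ?thesis using sin_zero_iff_int2 by blast
  qed
  ultimately have "1 + 2 * (\<Sum>j = 1..(n - 1) div 2. cos (real j * x)) = 0"
    using dirichlet_kernel[of x "(n - 1) div 2"] by simp
  then show ?thesis using False by (simp add: x_def mult_ac)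
qed

text \<open>
  The entry \<open>(1, 0)\<close> is \<open>(2 / n) cos (2 j \<pi> / n)\<close>, and on these \<open>j\<close> the angle stays in \<open>[0, \<pi>]\<close>, where the
  cosine is injective.
\<close>
lemma U_pi2_inj:
  assumes "3 \<le> n"
  shows "inj_on (U_pi2 n) {1..(n - 1) div 2}"
proof (rule inj_onI)
  fix i j assume i: "i \<in> {1..(n - 1) div 2}" and j: "j \<in> {1..(n - 1) div 2}" and eq: "U_pi2 n i = U_pi2 n j"
  have range: "0 \<le> 2 * real k * pi / real n" "2 * real k * pi / real n \<le> pi" if "k \<in> {1..(n - 1) div 2}" for k
  proof -
    have "2 * k \<le> n" using that by auto
    then have "2 * real k \<le> real n" by (metis of_nat_le_iff of_nat_mult of_nat_numeral)
    then have "2 * real k * pi \<le> real n * pi" by (rule mult_right_mono) simp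
    then show "2 * real k * pi / real n \<le> pi" using assms by (simp add: field_simps)
  qed simp
  have "U_pi2 n i $$ (1, 0) = U_pi2 n j $$ (1, 0)" by (simp only: eq)
  then have "complex_of_real (2 / real n * cos (2 * real i * pi / real n)) =
      complex_of_real (2 / real n * cos (2 * real j * pi / real n))"
    using assms unfolding U_pi2_eq by simp
  then have "2 / real n * cos (2 * real i * pi / real n) = 2 / real n * cos (2 * real j * pi / real n)"
    by (simp only: of_real_eq_iff)
  then have "cos (2 * real i * pi / real n) = cos (2 * real j * pi / real n)"
    using assms by simp
  then have "2 * real i * pi / real n = 2 * real j * pi / real n"
    by (rule cos_inj_pi[OF range[OF i] range[OF j]])
  then show "i = j" using assms by simp
qed

text \<open>
  The diagonal entries differ: \<open>1 / n\<close> against \<open>2 / n\<close>.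
\<close>
lemma U_triv_not_U_pi2:
  assumes "3 \<le> n"
  shows "U_triv n \<notin> U_pi2 n ` S"
proof
  assume "U_triv n \<in> U_pi2 n ` S"
  then obtain j where "U_triv n = U_pi2 n j" by blast
  then have "U_triv n $$ (0, 0) = U_pi2 n j $$ (0, 0)" by simp
  then show False using assms unfolding U_pi2_eq by (simp add: U_triv_def)
qed

lemma idempotents_sum:
  assumes n: "3 \<le> n" and odd: "odd n"
  shows "(\<Oplus>\<^bsub>MM_ring n\<^esub>U\<in>{U_triv n} \<union> U_pi2 n ` {1..(n - 1) div 2}. U) = 1\<^sub>m n" (is "?S = _")
proof (rule eq_matI)
  interpret R: ring "MM_ring n" by (rule ring_MM_ring)
  let ?J = "{1..(n - 1) div 2}"
  have sub: "{U_triv n} \<union> U_pi2 n ` ?J \<subseteq> MM n" using U_triv_mem U_pi2_mem by blast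
  have "?S \<in> carrier (MM_ring n)" by (rule R.finsum_closed) (use sub in auto)
  then have S: "?S \<in> carrier_mat n n" using MM_carrier by simp
  then show "dim_row ?S = dim_row (1\<^sub>m n)" "dim_col ?S = dim_col (1\<^sub>m n)" by auto
  fix a b assume "a < dim_row (1\<^sub>m n :: complex mat)" "b < dim_col (1\<^sub>m n :: complex mat)"
  then have a: "a < n" and b: "b < n" by auto
  let ?w = "\<lambda>j. cos (2 * (real a - real b) * real j * pi / real n)"
  have "?S $$ (a, b) = (\<Sum>U\<in>{U_triv n} \<union> U_pi2 n ` ?J. U $$ (a, b))"
    by (rule finsum_mat_index[OF R.abelian_monoid_axioms])
      (use a b sub MM_carrier in auto)
  also have "\<dots> = U_triv n $$ (a, b) + (\<Sum>U\<in>U_pi2 n ` ?J. U $$ (a, b))"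
    using U_triv_not_U_pi2[OF n] by simp
  also have "\<dots> = U_triv n $$ (a, b) + (\<Sum>j\<in>?J. U_pi2 n j $$ (a, b))"
    by (simp only: sum.reindex[OF U_pi2_inj[OF n]] o_def)
  also have "\<dots> = complex_of_real (1 / real n + (\<Sum>j\<in>?J. 2 / real n * ?w j))"
    using a b unfolding U_pi2_eq by (simp add: U_triv_def)
  also have "1 / real n + (\<Sum>j\<in>?J. 2 / real n * ?w j) = (1 + 2 * (\<Sum>j\<in>?J. ?w j)) / real n"
    by (simp add: sum_distrib_left add_divide_distrib sum_divide_distrib)
  also have "\<dots> = (if a = b then 1 else 0)" unfolding cosine_sum[OF odd a b] using n by simp
  finally show "?S $$ (a, b) = 1\<^sub>m n $$ (a, b)" using a b by simp
qed

theorem theorem3: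
  fixes n :: nat
  assumes "n \<ge> 3" and "odd n"
  shows "complete_orthogonal_idempotents (MM_ring n)
           ({U_triv n} \<union> U_pi2 n ` {1..(n - 1) div 2}) \<and>
         card ({U_triv n} \<union> U_pi2 n ` {1..(n - 1) div 2}) = (n + 1) div 2 \<and>
         corresponds n (U_triv n) 1 triv_rep \<and>
         (\<forall>j\<in>{1..(n - 1) div 2}.
            corresponds n (U_pi2 n j) 2 (pi2 n \<circ> phi n j) \<and>
            U_pi2 n j = mat n n (\<lambda>(a, b).
              complex_of_real (2 / real n * cos (2 * (real a - real b) * real j * pi / real n))))"
proof (intro conjI ballI)
  let ?J = "{1..(n - 1) div 2}"
  let ?S = "{U_triv n} \<union> U_pi2 n ` ?J"
  show triv: "corresponds n (U_triv n) 1 triv_rep" by (rule corresponds_triv) (use assms in simp)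
  have pi2: "corresponds n (U_pi2 n j) 2 (pi2 n \<circ> phi n j)" if "j \<in> ?J" for j
    by (rule corresponds_pi2[OF assms(1) that])
  then show "corresponds n (U_pi2 n j) 2 (pi2 n \<circ> phi n j)" if "j \<in> ?J" for j
    using that .
  show "U_pi2 n j = mat n n (\<lambda>(a, b).
      complex_of_real (2 / real n * cos (2 * (real a - real b) * real j * pi / real n)))" for j
    by (rule U_pi2_eq)
  have "card ?S = Suc ((n - 1) div 2)"
    using U_triv_not_U_pi2[OF assms(1)] card_image[OF U_pi2_inj[OF assms(1)]] by simp
  also have "\<dots> = (n + 1) div 2" using assms(2) by (auto elim: oddE)
  finally show "card ?S = (n + 1) div 2" .
  have block: "simple_ideal {A * U | A. A \<in> MM n} (MM_ring n)"
    "ideal_identity U {A * U | A. A \<in> MM n} (MM_ring n)" if U: "U \<in> ?S" for U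
  proof -
    have "\<exists>d \<rho>. corresponds n U d \<rho>" using U triv pi2 by blast
    then show "simple_ideal {A * U | A. A \<in> MM n} (MM_ring n)"
      "ideal_identity U {A * U | A. A \<in> MM n} (MM_ring n)"
      unfolding corresponds_def by blast+
  qed
  show "complete_orthogonal_idempotents (MM_ring n) ?S"
  proof (rule ring.simple_ideal_identities_complete[OF ring_MM_ring _ block])
    show "finite ?S" by simp
    show "(\<Oplus>\<^bsub>MM_ring n\<^esub>U\<in>?S. U) = \<one>\<^bsub>MM_ring n\<^esub>"
      unfolding idempotents_sum[OF assms] by simp
  qed
qed

end
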